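(* Suppose Assumptions 1 and 2 hold, $\bar\xi_0\in\Xi_0$, $k\in\mathcal V$ (canonical scenario tree) and $W\in\mathbb Z_{\ge0}\cup\{\infty\}$. Then $\mathrm{EP}(k,W,\mathbf 0)$ has a unique primal-dual solution $\underline{\mathbf z}^{(k,W)}=\{\underline z^{(k,W)}_i\}_{i\in\mathcal V^{(k)}_{t(k):t(k)+W}}$, and there exist block matrices $\underline{\boldsymbol\Omega}^{(k,W)}$, $\underline{\boldsymbol\Psi}^{(k,W)}$ indexed by $\mathcal V^{(k)}_{t(k):t(k)+W}\times\mathcal V^{(k)}_{t(k):t(k)+W}$ such that $\underline{\mathbf z}^{(k,W)}=\underline{\boldsymbol\Omega}^{(k,W)}\underline{\mathbf p}_{\mathcal V^{(k)}_{t(k):t(k)+W}}$, $\underline{\mathbf w}^{(k,W)}=\underline{\boldsymbol\Psi}^{(k,W)}\underline{\mathbf p}_{\mathcal V^{(k)}_{t(k):t(k)+W}}$, and for all $t,t'\in\mathcal T_{t(k):t(k)+W}$, $$\|\underline{\boldsymbol\Omega}^{(k,W)}_{\mathcal V^{(k)}_t,\mathcal V^{(k)}_{t'}}\|_\pi\vee\|\underline{\boldsymbol\Psi}^{(k,W)}_{\mathcal V^{(k)}_t,\mathcal V^{(k)}_{t'}}\|_\pi\le c_1\rho^{|t-t'|}.$$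
   Context: Setting. $\mathcal T=\{0,\dots,T\}$, $\mathcal T_{a:b}=\mathcal T\cap\{a,\dots,b\}$ (equal to $\mathcal T_{a:T}$ if $b>T$ or $b=\infty$); $\boldsymbol\xi=(\xi_0,\dots,\xi_T)$ a stochastic process in a measurable set $\Xi$; $\boldsymbol\xi_{0:t}=(\xi_0,\dots,\xi_t)$; data functions $A,B,d,Q,R,q,r$ on $\Xi$ valued in $\mathbb R^{n_x\times n_x},\mathbb R^{n_x\times n_u},\mathbb R^{n_x},\mathbb S_{n_x},\mathbb S_{n_u},\mathbb R^{n_x},\mathbb R^{n_u}$; for $w=[x;u]$: $f(w;\xi)=A(\xi)x+B(\xi)u+d(\xi)$, $\ell(w;\xi)=\tfrac12x^\top Q(\xi)x+\tfrac12u^\top R(\xi)u-q(\xi)^\top x-r(\xi)^\top u$, $p(\xi)=[q(\xi);r(\xi);d(\xi)]$. Assumption 1: $\boldsymbol\xi$ has finite support. Assumption 2: there exist $L\ge1$, $\alpha\in(0,1)$, $\gamma\in(0,1]$ such that (a) $\|A(\xi_t)\|,\|B(\xi_t)\|,\|Q(\xi_t)\|,\|R(\xi_t)\|\le L$ a.s.; (b) $Q(\xi_t)\succeq0$, $R(\xi_t)\succeq\gamma I$ a.s.; (c) there are $K_t(\boldsymbol\xi_{0:t})$, $t\in\mathcal T_{0:T-1}$ (functions of $\boldsymbol\xi_{0:t}$ only), $\|K_t\|\le L$ a.s., such that $\|\Phi_{t''}\cdots\Phi_{t'+1}\|\le L\alpha^{t''-t'}$ a.s. for all $t'<t''$ in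 $\mathcal T$ with $\Phi_t=A(\xi_t)-B(\xi_t)K_{t-1}(\boldsymbol\xi_{0:t-1})$; (d) there are $K'_t(\boldsymbol\xi_{0:t})$, $t\in\mathcal T_{1:T}$, $\|K'_t\|\le L$ a.s., such that the same holds with $\Phi_t=A(\xi_t)-K'_t(\boldsymbol\xi_{0:t})Q(\xi_{t-1})^{1/2}$. Canonical scenario tree (given $\bar\xi_0$): $\mathcal V=\bigcup_{t\in\mathcal T}\{\boldsymbol\zeta_{0:t}$ in the support of $\boldsymbol\xi_{0:t}$ with $\zeta_0=\bar\xi_0\}$; node $i=\boldsymbol\zeta_{0:t}$ has stage $t(i)=t$, parent $a(i)=\boldsymbol\zeta_{0:t-1}$, realization $\underline\xi_i=\zeta_t$, probability $\pi_i=\mathbb P[\boldsymbol\xi_{0:t}=\boldsymbol\zeta_{0:t}\mid\xi_0=\bar\xi_0]$; $\pi_{i|k}=\pi_i/\pi_k$; $\mathcal V^{(k)}_t$ descendants of $k$ (nodes having $k$ as initial segment, including $k$) at stage $t$, $\mathcal V^{(k)}_{a:b}=\bigcup_{t\in\mathcal T_{a:b}}\mathcal V^{(k)}_t$. $\underline p_i=p(\underline\xi_i)$, $\underline{\mathbf p}_{\mathcal V'}=\{\underline p_i\}_{i\in\mathcal V'}$. Extensive problem $\mathrm{EP}(k,W,\bar w)$ for $\tau=t(k)$: minimize $\sum_{i\in\mathcal V^{(k)}_{\tau:\tau+W}}\pi_{i|k}\ell(\underline w_i;\underline\xi_i)$ over $\underline w_i=[\underline x_i;\underline u_i]$ subject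 to $\underline x_k=f(\bar w;\underline\xi_k)$ (multiplier $\underline y_k$) and $\pi_{i|k}\underline x_i=\pi_{i|k}f(\underline w_{a(i)};\underline\xi_i)$ (multiplier $\underline y_i$) for $i\in\mathcal V^{(k)}_{\tau+1:\tau+W}$; $\underline z_i=[\underline w_i;\underline y_i]$. Scaled norm: $\|\mathbf M_{\mathcal V',\mathcal V''}\|_\pi=\max\{\|\{\pi_i^{1/2}(\mathbf M_{\mathcal V',\mathcal V''}\mathbf v)_i\}_{i\in\mathcal V'}\|:\|\{\pi_j^{1/2}v_j\}_{j\in\mathcal V''}\|\le1\}$ for the block submatrix $\mathbf M_{\mathcal V',\mathcal V''}=\{M_{ij}\}_{i\in\mathcal V',j\in\mathcal V''}$. Constants: $L_H=2L+1$, $\gamma_F=\frac{(1-\alpha)^2}{(1+L)^2L^2}$, $\gamma_G=\frac{\gamma(1-\alpha)^2}{2(1+L)^2L^4}$, $\bar\mu=\frac{2L_H^2/\gamma_G+\gamma_G+L_H}{\gamma_F}$, $\gamma_H=\Big(\frac2{\gamma_G}+\big(1+\frac{4L_H}{\gamma_G}+\frac{4L_H^2}{\gamma_G^2}\big)\frac{L_H(1+\bar\mu L_H)}{\gamma_F}+\bar\mu\Big)^{-1}$, $\rho=\big(\frac{L_H^2-\gamma_H^2}{L_H^2+\gamma_H^2}\big)^{1/2}$, $c_1=\frac{L_H}{\gamma_H^2\rho}$. $a\vee b=\max(a,b)$. *)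

theory Defs
  imports "HOL-Analysis.Analysis" "HOL-Probability.Probability_Mass_Function"
begin

definition opnorm :: "real^'n^'m \<Rightarrow> real" where
  "opnorm M = onorm (\<lambda>v. M *v v)"

definition psd :: "real^'n^'n \<Rightarrow> bool" where
  "psd M \<longleftrightarrow> (\<forall>v. 0 \<le> v \<bullet> (M *v v))"

definition psd_sqrt :: "real^'n^'n \<Rightarrow> real^'n^'n" where
  "psd_sqrt M = (THE S. transpose S = S \<and> psd S \<and> S ** S = M)"

fun stp :: "(nat \<Rightarrow> real^'n^'n) \<Rightarrow> nat \<Rightarrow> nat \<Rightarrow> real^'n^'n" where
  "stp Phi t' 0 = mat 1"
| "stp Phi t' (Suc n) = (if t' < Suc n then Phi (Suc n) ** stp Phi t' n else mat 1)"

text \<open>The process xi = (xi_0,...,xi_T) has law P on lists of length T+1.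
  Nodes are prefixes zeta_{0:t} of support points with zeta_0 = x0.\<close>
definition tree_nodes :: "'a list pmf \<Rightarrow> nat \<Rightarrow> 'a \<Rightarrow> 'a list set" where
  "tree_nodes P T x0 = {take (Suc t) s | s t. s \<in> set_pmf P \<and> hd s = x0 \<and> t \<le> T}"

definition stage :: "'a list \<Rightarrow> nat" where
  "stage i = length i - 1"

definition node_prob :: "'a list pmf \<Rightarrow> 'a \<Rightarrow> 'a list \<Rightarrow> real" where
  "node_prob P x0 i =
     measure_pmf.prob P {s. take (length i) s = i \<and> hd s = x0} / measure_pmf.prob P {s. hd s = x0}"

definition desc :: "'a list pmf \<Rightarrow> nat \<Rightarrow> 'a \<Rightarrow> 'a list \<Rightarrow> nat \<Rightarrow> 'a list set" where
  "desc P T x0 k t = {i \<in> tree_nodes P T x0. stage i = t \<and> take (length k) i = k}"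

definition win_stages :: "nat \<Rightarrow> 'a list \<Rightarrow> enat \<Rightarrow> nat set" where
  "win_stages T k W = {t. stage k \<le> t \<and> t \<le> T \<and> enat t \<le> enat (stage k) + W}"

definition win_nodes :: "'a list pmf \<Rightarrow> nat \<Rightarrow> 'a \<Rightarrow> 'a list \<Rightarrow> enat \<Rightarrow> 'a list set" where
  "win_nodes P T x0 k W = (\<Union>t\<in>win_stages T k W. desc P T x0 k t)"

definition fdyn :: "('a \<Rightarrow> real^'nx^'nx) \<Rightarrow> ('a \<Rightarrow> real^'nu^'nx) \<Rightarrow> ('a \<Rightarrow> real^'nx)
    \<Rightarrow> real^'nx \<Rightarrow> real^'nu \<Rightarrow> 'a \<Rightarrow> real^'nx" where
  "fdyn A B d x u \<xi> = A \<xi> *v x + B \<xi> *v u + d \<xi>"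

text \<open>z i = (x_i, u_i, y_i).  Lagrangian convention:
  sum_i pi_{i|k} [ l(w_i; xi_i) + y_i^T (f(w_{a(i)}; xi_i) - x_i) ], with w_{a(k)} = wbar = 0.
  The conditions below are stationarity of this Lagrangian in x_i and u_i plus primal feasibility
  (the KKT conditions, i.e. primal-dual optimality for this convex QP).\<close>
definition EP_KKT ::
  "'a list pmf \<Rightarrow> nat \<Rightarrow> 'a \<Rightarrow> ('a \<Rightarrow> real^'nx^'nx) \<Rightarrow> ('a \<Rightarrow> real^'nu^'nx) \<Rightarrow> ('a \<Rightarrow> real^'nx)
   \<Rightarrow> ('a \<Rightarrow> real^'nx^'nx) \<Rightarrow> ('a \<Rightarrow> real^'nu^'nu) \<Rightarrow> ('a \<Rightarrow> real^'nx) \<Rightarrow> ('a \<Rightarrow> real^'nu)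
   \<Rightarrow> 'a list \<Rightarrow> enat \<Rightarrow> ('a list \<Rightarrow> (real^'nx) \<times> (real^'nu) \<times> (real^'nx)) \<Rightarrow> bool" where
  "EP_KKT P T x0 A B d Q R q r k W z \<longleftrightarrow>
    (let V = win_nodes P T x0 k W;
         \<pi> = (\<lambda>i. node_prob P x0 i / node_prob P x0 k);
         x = (\<lambda>i. fst (z i)); u = (\<lambda>i. fst (snd (z i))); y = (\<lambda>i. snd (snd (z i)));
         ch = (\<lambda>i. {j \<in> V. j \<noteq> k \<and> butlast j = i})
     in \<forall>i\<in>V.
       \<pi> i *\<^sub>R (Q (last i) *v x i - q (last i) - y i)
         + (\<Sum>j\<in>ch i. \<pi> j *\<^sub>R (transpose (A (last j)) *v y j)) = 0
     \<and> \<pi> i *\<^sub>R (R (last i) *v u i - r (last i))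
         + (\<Sum>j\<in>ch i. \<pi> j *\<^sub>R (transpose (B (last j)) *v y j)) = 0
     \<and> (i = k \<longrightarrow> x i = fdyn A B d 0 0 (last i))
     \<and> (i \<noteq> k \<longrightarrow> \<pi> i *\<^sub>R x i = \<pi> i *\<^sub>R fdyn A B d (x (butlast i)) (u (butlast i)) (last i)))"

definition pinorm :: "('i \<Rightarrow> real) \<Rightarrow> 'i set \<Rightarrow> 'i set
    \<Rightarrow> ('i \<Rightarrow> 'i \<Rightarrow> 'v::real_normed_vector \<Rightarrow> 'w::real_normed_vector) \<Rightarrow> real" where
  "pinorm \<pi> Vr Vc M =
     (SUP v\<in>{v. (\<Sum>j\<in>Vc. \<pi> j * (norm (v j))\<^sup>2) \<le> 1}.
        sqrt (\<Sum>i\<in>Vr. \<pi> i * (norm (\<Sum>j\<in>Vc. M i j (v j)))\<^sup>2))"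

definition L_H :: "real \<Rightarrow> real" where "L_H L = 2 * L + 1"
definition gamma_F :: "real \<Rightarrow> real \<Rightarrow> real" where
  "gamma_F L \<alpha> = (1 - \<alpha>)\<^sup>2 / ((1 + L)\<^sup>2 * L\<^sup>2)"
definition gamma_G :: "real \<Rightarrow> real \<Rightarrow> real \<Rightarrow> real" where
  "gamma_G L \<alpha> \<gamma> = \<gamma> * (1 - \<alpha>)\<^sup>2 / (2 * (1 + L)\<^sup>2 * L ^ 4)"
definition mu_bar :: "real \<Rightarrow> real \<Rightarrow> real \<Rightarrow> real" where
  "mu_bar L \<alpha> \<gamma> = (2 * (L_H L)\<^sup>2 / gamma_G L \<alpha> \<gamma> + gamma_G L \<alpha> \<gamma> + L_H L) / gamma_F L \<alpha>"
definition gamma_H :: "real \<Rightarrow> real \<Rightarrow> real \<Rightarrow> real" where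
  "gamma_H L \<alpha> \<gamma> = inverse
     (2 / gamma_G L \<alpha> \<gamma>
      + (1 + 4 * L_H L / gamma_G L \<alpha> \<gamma> + 4 * (L_H L)\<^sup>2 / (gamma_G L \<alpha> \<gamma>)\<^sup>2)
        * (L_H L * (1 + mu_bar L \<alpha> \<gamma> * L_H L) / gamma_F L \<alpha>)
      + mu_bar L \<alpha> \<gamma>)"
definition rho :: "real \<Rightarrow> real \<Rightarrow> real \<Rightarrow> real" where
  "rho L \<alpha> \<gamma> = sqrt (((L_H L)\<^sup>2 - (gamma_H L \<alpha> \<gamma>)\<^sup>2) / ((L_H L)\<^sup>2 + (gamma_H L \<alpha> \<gamma>)\<^sup>2))"
definition c_1 :: "real \<Rightarrow> real \<Rightarrow> real \<Rightarrow> real" where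
  "c_1 L \<alpha> \<gamma> = L_H L / ((gamma_H L \<alpha> \<gamma>)\<^sup>2 * rho L \<alpha> \<gamma>)"

end

theory Submission
  imports Defs
begin

text \<open>
  In the inner product weighted by the node probabilities the KKT operator
  \<open>(x, u, y) \<mapsto> (Q x - F\<^sub>x\<^sup>* y, R u - F\<^sub>u\<^sup>* y, - F (x, u))\<close> is self-adjoint and couples only
  neighbouring stages. Its norm is at most \<open>L_H\<close>. It is bounded below by \<open>gamma_H\<close>, because the closed
  loop \<open>u = - K x\<close> gives a bounded right inverse of the dynamics \<open>F\<close>, and detectability makes the
  Hessian coercive on the kernel of \<open>F\<close>. Hence \<open>I - c H\<^sup>2\<close> with \<open>c = 2 / (L_H\<^sup>2 + gamma_H\<^sup>2)\<close> has norm
  at most \<open>rho\<^sup>2\<close>. Its powers provide the solution as a Neumann series, and they also provide the decay: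
  if \<open>H z = v\<close> with \<open>v\<close> supported on one stage, then \<open>z\<close> and \<open>(I - c H\<^sup>2)\<^sup>n z\<close> agree at distance \<open>2 n\<close> or more
  from that stage, so \<open>z\<close> has norm at most \<open>rho\<^sup>2\<^sup>n norm v / gamma_H\<close> there.
\<close>

text \<open>The KKT operator \<open>H\<close> is indefinite, so no step \<open>c\<close> makes
  \<open>I - c H\<close> a contraction. Squaring folds the spectrum into
  \<open>[g\<^sup>2, M\<^sup>2]\<close>; one application of \<open>I - c H\<^sup>2\<close> reaches
  two stages further and gains \<open>theta\<close>, which is the square of \<open>rho\<close>,
  hence \<open>rho\<close> per stage. The probability weights enter twice. Dividing a stationarity
  row by its conditional probability leaves child-to-parent ratios, which are exactly the adjoint of
  the parent shift; and in the weighted norm that shift has norm at most 1 whatever the branching,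
  so estimates along one trajectory carry over to the tree. Constants: \<open>1 / gamma_F\<close> is
  the square of the bound for the right inverse of \<open>F\<close>, \<open>gamma_G\<close> is the
  coercivity constant on its kernel, \<open>L_H\<close> bounds the quadratic form of
  \<open>H\<close>. The direct saddle point estimate is at least as good as \<open>gamma_H\<close>,
  so it is only compared with it. \<open>psd_sqrt\<close> is a definite description, so existence
  and uniqueness of roots must come before detectability can be used.\<close>

subsection \<open>Square roots of positive semidefinite matrices\<close>

text \<open>
  The iteration \<open>Y \<mapsto> (N + Y\<^sup>2) / 2\<close> is dominated step by step by the scalar iteration
  \<open>y \<mapsto> (1 + y\<^sup>2) / 2\<close>, which increases and is bounded by 1. With \<open>N = I - M / c\<close>, the fixed point
  gives \<open>(I - Y)\<^sup>2 = M / c\<close>.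
\<close>
lemma contractive_selfadjoint_quadratic_fixpoint:
  fixes N :: "'a::euclidean_space \<Rightarrow>\<^sub>L 'a"
  assumes sa: "\<And>v w. blinfun_apply N v \<bullet> w = v \<bullet> blinfun_apply N w" and N1: "norm N \<le> 1"
  shows "\<exists>Y::'a \<Rightarrow>\<^sub>L 'a. (\<forall>v w. blinfun_apply Y v \<bullet> w = v \<bullet> blinfun_apply Y w) \<and> norm Y \<le> 1 \<and> Y + Y = N + (Y o\<^sub>L Y)"
proof -
  define Y :: "nat \<Rightarrow> 'a \<Rightarrow>\<^sub>L 'a" where "Y = rec_nat 0 (\<lambda>_ Z. (1/2) *\<^sub>R (N + (Z o\<^sub>L Z)))"
  define y :: "nat \<Rightarrow> real" where "y = rec_nat 0 (\<lambda>_ z. (1 + z\<^sup>2) / 2)"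
  have Y0: "Y 0 = 0" and YS: "Y (Suc n) = (1/2) *\<^sub>R (N + (Y n o\<^sub>L Y n))" for n by (simp_all add: Y_def)
  have y0: "y 0 = 0" and yS: "y (Suc n) = (1 + (y n)\<^sup>2) / 2" for n by (simp_all add: y_def)
  have y01: "0 \<le> y n \<and> y n \<le> 1" for n
    by (induction n) (auto simp: y0 yS power_le_one)
  \<comment> \<open>Every iterate is a polynomial in \<open>N\<close>, so all iterates commute; this
    gives their self-adjointness and the factorization of the difference of squares below.\<close>
  have cN: "Y n (N v) = N (Y n v)" for n v
    by (induction n arbitrary: v) (simp_all add: Y0 YS blinfun.bilinear_simps)
  have cY: "Y n (Y (Suc n) v) = Y (Suc n) (Y n v)" for n v
    by (simp add: YS blinfun.bilinear_simps cN)
  have saY: "Y n v \<bullet> w = v \<bullet> Y n w" for n v w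
    by (induction n arbitrary: v w) (simp_all add: Y0 YS blinfun.bilinear_simps inner_add_left inner_add_right sa cN)
  have nY: "norm (Y n) \<le> y n" for n
  proof (induction n)
    case (Suc n)
    have "norm (Y n o\<^sub>L Y n) \<le> y n * y n"
      by (rule order_trans[OF norm_blinfun_compose]) (intro mult_mono Suc norm_ge_zero order_trans[OF norm_ge_zero Suc])
    then have "norm (N + (Y n o\<^sub>L Y n)) \<le> 1 + (y n)\<^sup>2"
      using norm_triangle_ineq[of N "Y n o\<^sub>L Y n"] N1 by (simp add: power2_eq_square)
    then show ?case by (simp add: YS yS)
  qed (simp add: Y0 y0)
  have dY: "norm (Y (Suc n) - Y n) \<le> y (Suc n) - y n" for n
  proof (induction n)
    case 0 show ?case using N1 by (simp add: Y0 YS y0 yS)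
  next
    case (Suc n)
    have "Y (Suc (Suc n)) - Y (Suc n) = (1/2) *\<^sub>R ((Y (Suc n) - Y n) o\<^sub>L (Y (Suc n) + Y n))"
      using cY by (intro blinfun_eqI)
        (simp add: YS[of "Suc n"] YS[of n, symmetric] blinfun.bilinear_simps algebra_simps,
         simp add: YS blinfun.bilinear_simps algebra_simps)
    moreover have "norm ((Y (Suc n) - Y n) o\<^sub>L (Y (Suc n) + Y n)) \<le> (y (Suc n) - y n) * (y (Suc n) + y n)"
      by (rule order_trans[OF norm_blinfun_compose])
        (intro mult_mono Suc order_trans[OF norm_triangle_ineq] add_mono nY norm_ge_zero
          order_trans[OF norm_ge_zero Suc])
    ultimately have "norm (Y (Suc (Suc n)) - Y (Suc n)) \<le> (1/2) * ((y (Suc n) - y n) * (y (Suc n) + y n))"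
      by simp
    also have "\<dots> = y (Suc (Suc n)) - y (Suc n)"
      by (simp add: yS[of "Suc n"]) (simp add: yS[of n] power2_eq_square field_simps)
    finally show ?case .
  qed
  \<comment> \<open>The increments of \<open>y\<close> telescope to a finite sum and dominate those
    of \<open>Y\<close> in norm, so \<open>Y\<close> converges.\<close>
  have "incseq y" using order_trans[OF norm_ge_zero dY] by (intro incseq_SucI) simp
  then obtain l where "y \<longlonglongrightarrow> l" using y01 by (metis incseq_convergent)
  then have "summable (\<lambda>n. y (Suc n) - y n)" by (rule telescope_summable)
  then have "summable (\<lambda>n. Y (Suc n) - Y n)"
    by (rule summable_comparison_test'[where N=0]) (use dY in auto)
  then have "(\<lambda>n. \<Sum>i<n. Y (Suc i) - Y i) \<longlonglongrightarrow> (\<Sum>i. Y (Suc i) - Y i)" by (rule summable_LIMSEQ)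
  then obtain Z where Z: "Y \<longlonglongrightarrow> Z" by (auto simp: sum_lessThan_telescope Y0)
  have "(\<lambda>n. (1/2) *\<^sub>R (N + (Y n o\<^sub>L Y n))) \<longlonglongrightarrow> (1/2) *\<^sub>R (N + (Z o\<^sub>L Z))"
    by (intro tendsto_intros bounded_bilinear.tendsto[OF bounded_bilinear_blinfun_compose] Z)
  then have "(\<lambda>n. Y (Suc n)) \<longlonglongrightarrow> (1/2) *\<^sub>R (N + (Z o\<^sub>L Z))" by (simp add: YS)
  then have "(1/2) *\<^sub>R (N + (Z o\<^sub>L Z)) = Z" using LIMSEQ_unique LIMSEQ_Suc[OF Z] by blast
  then have "2 *\<^sub>R Z = 2 *\<^sub>R ((1/2) *\<^sub>R (N + (Z o\<^sub>L Z)))" by simp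
  then have "Z + Z = N + (Z o\<^sub>L Z)" by (simp add: scaleR_2)
  moreover have "Z v \<bullet> w = v \<bullet> Z w" for v w
  proof -
    have "(\<lambda>n. Y n v \<bullet> w) \<longlonglongrightarrow> Z v \<bullet> w" "(\<lambda>n. v \<bullet> Y n w) \<longlonglongrightarrow> v \<bullet> Z w"
      by (intro tendsto_intros Z)+
    then show ?thesis using saY LIMSEQ_unique by auto
  qed
  moreover have "norm Z \<le> 1"
    using LIMSEQ_le_const2[OF tendsto_norm[OF Z]] order_trans[OF nY] y01 by blast
  ultimately show ?thesis by blast
qed

text \<open>Positivity of the form at \<open>v - f v\<close> replaces the spectral theorem:
  expanding it gives 2 |f v|^2 \<le> |v|^2 + |f v|^2.\<close>

lemma psd_form_norm_le:
  fixes f :: "'a::real_inner \<Rightarrow> 'a"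
  assumes "linear f" and sa: "\<And>v w. f v \<bullet> w = v \<bullet> f w"
    and pos: "\<And>v. 0 \<le> v \<bullet> f v" and le: "\<And>v. v \<bullet> f v \<le> v \<bullet> v"
  shows "norm (f v) \<le> norm v"
proof -
  interpret linear f by fact
  have "0 \<le> (v - f v) \<bullet> f (v - f v)" by (rule pos)
  then have "0 \<le> v \<bullet> f v - 2 * (f v \<bullet> f v) + f v \<bullet> f (f v)"
    by (simp add: diff inner_diff_left inner_diff_right sa)
  then have "f v \<bullet> f v \<le> v \<bullet> v" using le[of "f v"] le[of v] by linarith
  then show ?thesis by (simp add: norm_eq_sqrt_inner)
qed

lemma inner_transpose_matrix: "(M *v v) \<bullet> w = v \<bullet> (transpose M *v w)"
  for M :: "real^'n^'m"
  by (metis dot_lmul_matrix inner_commute transpose_matrix_vector)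

lemma norm_matrix_vector_le_opnorm: "norm (M *v v) \<le> opnorm M * norm v" for M :: "real^'n^'m"
  unfolding opnorm_def by (rule onorm) (simp add: matrix_vector_mul_bounded_linear)

lemma psd_sqrt_exists:
  fixes M :: "real^'n^'n"
  assumes sym: "transpose M = M" and pos: "psd M"
  shows "\<exists>S. transpose S = S \<and> psd S \<and> S ** S = M"
proof -
  \<comment> \<open>The 1 keeps \<open>c\<close> positive for M = 0, and c \<ge>
    \<open>opnorm M\<close> puts the form of I - M/c between 0 and 1.\<close>
  define c where "c = opnorm M + 1"
  have "0 \<le> opnorm M" unfolding opnorm_def by (rule onorm_pos_le) (simp add: matrix_vector_mul_bounded_linear)
  then have c: "c > 0" "opnorm M \<le> c" by (auto simp: c_def)
  define f where "f = (\<lambda>v. v - (1/c) *\<^sub>R (M *v v))"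
  have lf: "linear f" unfolding f_def
    by (intro linear_compose_sub linear_id[unfolded id_def] linear_compose_scale_right matrix_vector_mul_linear)
  have saM: "(M *v v) \<bullet> w = v \<bullet> (M *v w)" for v w using inner_transpose_matrix[of M v w] sym by simp
  have saf: "f v \<bullet> w = v \<bullet> f w" for v w
    by (simp add: f_def inner_diff_left inner_diff_right saM)
  have le: "v \<bullet> (M *v v) \<le> c * (v \<bullet> v)" for v
  proof -
    have "v \<bullet> (M *v v) \<le> norm v * (opnorm M * norm v)"
      by (intro order_trans[OF norm_cauchy_schwarz] mult_left_mono norm_matrix_vector_le_opnorm) simp
    also have "\<dots> \<le> norm v * (c * norm v)" using c by (intro mult_left_mono mult_right_mono) auto
    also have "\<dots> = c * (v \<bullet> v)" by (simp add: dot_square_norm power2_eq_square)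
    finally show ?thesis .
  qed
  have "norm (f v) \<le> norm v" for v
  proof (rule psd_form_norm_le[OF lf saf])
    show "0 \<le> v \<bullet> f v" for v using le[of v] c by (simp add: f_def inner_diff_right field_simps)
    show "v \<bullet> f v \<le> v \<bullet> v" for v using pos c by (simp add: f_def inner_diff_right psd_def)
  qed
  moreover have bl: "bounded_linear f" using lf by (simp add: linear_conv_bounded_linear)
  ultimately have "norm (Blinfun f) \<le> 1" by (intro norm_blinfun_bound) (auto simp: bounded_linear_Blinfun_apply)
  then obtain Y where Y: "\<And>v w. blinfun_apply Y v \<bullet> w = v \<bullet> blinfun_apply Y w" "norm Y \<le> 1" "Y + Y = Blinfun f + (Y o\<^sub>L Y)"
    using contractive_selfadjoint_quadratic_fixpoint[of "Blinfun f"] saf bl by (auto simp: bounded_linear_Blinfun_apply)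
  \<comment> \<open>\<open>sqrt c\<close> undoes the scaling of M; the norm bound on
    \<open>Y\<close> makes I - Y positive.\<close>
  define g where "g = (\<lambda>v. sqrt c *\<^sub>R (v - Y v))"
  have lg: "linear g" unfolding g_def
    by (intro linear_compose_scale_right linear_compose_sub linear_id[unfolded id_def] bounded_linear.linear blinfun.bounded_linear_right)
  define S where "S = matrix g"
  have Sv: "S *v v = g v" for v using lg by (simp add: S_def matrix_works)
  have sg: "g v \<bullet> w = v \<bullet> g w" for v w by (simp add: g_def inner_diff_left inner_diff_right Y(1))
  have "S ** S = M"
  proof (rule matrix_eq[THEN iffD2], rule allI)
    fix v
    have "Y v + Y v = f v + Y (Y v)"
      using arg_cong[OF Y(3), of "\<lambda>Z. blinfun_apply Z v"] bl
      by (simp add: blinfun.bilinear_simps bounded_linear_Blinfun_apply)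
    then have "v - Y v - (Y v - Y (Y v)) = (1/c) *\<^sub>R (M *v v)" by (simp add: f_def algebra_simps)
    then have "c *\<^sub>R (v - Y v - (Y v - Y (Y v))) = M *v v" using c by simp
    moreover have "g (g v) = c *\<^sub>R (v - Y v - (Y v - Y (Y v)))"
      using c by (simp add: g_def blinfun.bilinear_simps flip: scaleR_diff_right)
    ultimately show "(S ** S) *v v = M *v v" by (simp add: Sv flip: matrix_vector_mul_assoc)
  qed
  moreover have "transpose S = S"
  proof (rule matrix_eq[THEN iffD2], rule allI)
    fix v
    show "transpose S *v v = S *v v"
      by (rule vector_eq_ldot[THEN iffD1])
        (metis Sv sg inner_transpose_matrix)
  qed
  moreover have "psd S"
    unfolding psd_def
  proof
    fix v
    have "v \<bullet> Y v \<le> norm v * (norm Y * norm v)"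
      by (intro order_trans[OF norm_cauchy_schwarz] mult_left_mono norm_blinfun) simp
    also have "\<dots> \<le> norm v * (1 * norm v)" using Y(2) by (intro mult_left_mono mult_right_mono) auto
    finally have "v \<bullet> Y v \<le> v \<bullet> v" by (simp add: dot_square_norm power2_eq_square)
    then show "0 \<le> v \<bullet> (S *v v)" using c by (simp add: Sv g_def inner_diff_right)
  qed
  ultimately show ?thesis by blast
qed

text \<open>The form is the squared norm of U v for a symmetric root U of S.\<close>

lemma psd_inner_zero:
  fixes S :: "real^'n^'n"
  assumes "transpose S = S" "psd S" "v \<bullet> (S *v v) = 0"
  shows "S *v v = 0"
proof -
  obtain U where U: "transpose U = U" "U ** U = S" using psd_sqrt_exists[OF assms(1,2)] by blast
  have "(U *v v) \<bullet> (U *v v) = v \<bullet> (S *v v)"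
    using U by (simp add: inner_transpose_matrix matrix_vector_mul_assoc)
  then have "U *v v = 0" using assms(3) by simp
  then show ?thesis using U(2) by (metis matrix_vector_mul_assoc matrix_vector_mult_0_right)
qed

text \<open>The two roots are not assumed to commute, so S^2 - U^2 does not factor; a trace argument
  takes the place of the factorization.\<close>

lemma psd_sqrt_unique:
  fixes S :: "real^'n^'n"
  assumes S: "transpose S = S" "psd S" and U: "transpose U = U" "psd U" and eq: "S ** S = U ** U"
  shows "S = U"
proof -
  define D where "D v = S *v v - U *v v" for v
  have sD: "D v \<bullet> w = v \<bullet> D w" for v w
    by (simp add: D_def inner_diff_left inner_diff_right inner_transpose_matrix S U)
  have anti: "S *v D v = - D (U *v v)" for v
    using arg_cong[OF eq, of "\<lambda>X. X *v v"]
    by (simp add: D_def matrix_vector_mult_diff_distrib flip: matrix_vector_mul_assoc)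
  \<comment> \<open>\<open>S D + D U = S\<^sup>2 - U\<^sup>2 = 0\<close>, so \<open>tr (D S D) + tr (D U D) = 0\<close> with both terms nonnegative.\<close>
  have tr: "(\<Sum>b\<in>Basis. D (U *v b) \<bullet> D b) = (\<Sum>b\<in>Basis. D b \<bullet> (U *v D b))"
  proof -
    have "(\<Sum>b\<in>Basis. D (U *v b) \<bullet> D b) = (\<Sum>b\<in>Basis. \<Sum>c\<in>Basis. (D (U *v b) \<bullet> c) * (D b \<bullet> c))"
      by (subst euclidean_inner) simp
    also have "\<dots> = (\<Sum>b\<in>Basis. \<Sum>c\<in>Basis. (b \<bullet> (U *v D c)) * (b \<bullet> D c))"
      by (simp add: sD inner_transpose_matrix U)
    also have "\<dots> = (\<Sum>c\<in>Basis. \<Sum>b\<in>Basis. (b \<bullet> (U *v D c)) * (b \<bullet> D c))" by (rule sum.swap)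
    also have "\<dots> = (\<Sum>c\<in>Basis. D c \<bullet> (U *v D c))"
      by (subst (2) euclidean_inner) (simp add: inner_commute mult.commute)
    finally show ?thesis .
  qed
  have "(\<Sum>b\<in>Basis. D b \<bullet> (S *v D b) + D b \<bullet> (U *v D b)) = 0"
    using tr by (simp add: anti sum.distrib sum_negf sum_subtractf inner_commute[of "D (U *v _)"])
  moreover have ge: "0 \<le> D b \<bullet> (S *v D b)" "0 \<le> D b \<bullet> (U *v D b)" for b
    using S U by (auto simp: psd_def)
  ultimately have z: "D b \<bullet> (S *v D b) + D b \<bullet> (U *v D b) = 0" if "b \<in> Basis" for b
    using that by (subst (asm) sum_nonneg_eq_0_iff) auto
  have "D b = 0" if b: "b \<in> Basis" for b
  proof -
    \<comment> \<open>Both forms vanish at \<open>D b\<close>, so S and U annihilate it, and hence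
      so does their difference \<open>D\<close>.\<close>
    have "D (D b) = 0" using psd_inner_zero[OF S] psd_inner_zero[OF U] z[OF b] ge[of b]
      by (simp add: D_def) (smt (verit, best) diff_zero)
    then have "D b \<bullet> D b = 0" by (subst sD) simp
    then show ?thesis by simp
  qed
  then have "(\<lambda>v. S *v v) = (\<lambda>v. U *v v)"
    by (intro ext linear_eq_stdbasis) (auto simp: D_def matrix_vector_mul_linear)
  then show ?thesis by (simp add: matrix_eq fun_eq_iff)
qed

text \<open>The bridge from detectability to the cost: the observation of x through the root has the
  state cost as its squared norm.\<close>

lemma psd_sqrt_inner:
  fixes M :: "real^'n^'n"
  assumes "transpose M = M" "psd M"
  shows "(norm (psd_sqrt M *v v))\<^sup>2 = v \<bullet> (M *v v)"
proof -
  have "\<exists>!S. transpose S = S \<and> psd S \<and> S ** S = M"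
    proof (rule ex_ex1I[OF psd_sqrt_exists[OF assms]])
    show "S = U" if "transpose S = S \<and> psd S \<and> S ** S = M" "transpose U = U \<and> psd U \<and> U ** U = M" for S U
      using that psd_sqrt_unique[of S U] by simp
  qed
  from theI'[OF this] have "transpose (psd_sqrt M) = psd_sqrt M" "psd_sqrt M ** psd_sqrt M = M"
    unfolding psd_sqrt_def by auto
  then show ?thesis
    by (simp add: inner_transpose_matrix matrix_vector_mul_assoc power2_norm_eq_inner)
qed

subsection \<open>Banded self-adjoint operators in a weighted inner product\<close>

text \<open>Vectors are total functions on the index type, so \<open>nrm\<close> is only a seminorm
  and equalities are claimed on \<open>V\<close>.\<close>

locale weighted_space =
  fixes V :: "'i set" and p :: "'i \<Rightarrow> real"
  assumes finV: "finite V" and p_pos: "i \<in> V \<Longrightarrow> 0 < p i"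
begin

definition ip :: "('i \<Rightarrow> 'v::real_inner) \<Rightarrow> ('i \<Rightarrow> 'v) \<Rightarrow> real" where
  "ip f g = (\<Sum>i\<in>V. p i * (f i \<bullet> g i))"

text \<open>With \<open>L2_set\<close>, the weighted Cauchy-Schwarz and triangle inequalities reduce
  to the unweighted ones.\<close>

definition nrm :: "('i \<Rightarrow> 'v::real_normed_vector) \<Rightarrow> real" where
  "nrm f = L2_set (\<lambda>i. sqrt (p i) * norm (f i)) V"

lemma p_ge: "i \<in> V \<Longrightarrow> 0 \<le> p i"
  using p_pos by (simp add: less_imp_le)

lemma nrm_power2_sum: "(nrm f)\<^sup>2 = (\<Sum>i\<in>V. p i * (norm (f i))\<^sup>2)"
  unfolding nrm_def L2_set_def
  by (subst real_sqrt_pow2) (auto intro!: sum_nonneg sum.cong simp: power_mult_distrib p_ge)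

lemma nrm_power2: "(nrm f)\<^sup>2 = ip f f"
  by (simp add: nrm_power2_sum ip_def power2_norm_eq_inner)

lemma nrm_ge_0 [simp]: "0 \<le> nrm f"
  by (simp add: nrm_def)

lemma ip_commute: "ip f g = ip g f"
  by (simp add: ip_def inner_commute)

lemma ip_add_left: "ip (\<lambda>i. f i + g i) h = ip f h + ip g h"
  and ip_add_right: "ip h (\<lambda>i. f i + g i) = ip h f + ip h g"
  and ip_diff_left: "ip (\<lambda>i. f i - g i) h = ip f h - ip g h"
  and ip_diff_right: "ip h (\<lambda>i. f i - g i) = ip h f - ip h g"
  and ip_scale_left: "ip (\<lambda>i. c *\<^sub>R f i) h = c * ip f h"
  and ip_scale_right: "ip h (\<lambda>i. c *\<^sub>R f i) = c * ip h f"
  and ip_minus_left: "ip (\<lambda>i. - f i) h = - ip f h"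
  and ip_minus_right: "ip h (\<lambda>i. - f i) = - ip h f"
  by (simp_all add: ip_def inner_add_left inner_add_right inner_diff_left inner_diff_right distrib_left
      right_diff_distrib mult.left_commute sum.distrib sum_subtractf sum_distrib_left sum_negf)

lemmas ip_simps = ip_add_left ip_add_right ip_diff_left ip_diff_right ip_scale_left ip_scale_right
  ip_minus_left ip_minus_right

lemma nrm_cong: "(\<And>i. i \<in> V \<Longrightarrow> f i = g i) \<Longrightarrow> nrm f = nrm g"
  by (simp add: nrm_def L2_set_def)

lemma abs_ip_le: "\<bar>ip f g\<bar> \<le> nrm f * nrm g"
proof -
  have "\<bar>ip f g\<bar> \<le> (\<Sum>i\<in>V. \<bar>sqrt (p i) * norm (f i)\<bar> * \<bar>sqrt (p i) * norm (g i)\<bar>)"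
    unfolding ip_def
  proof (rule order_trans[OF sum_abs sum_mono])
    fix i assume i: "i \<in> V"
    have "\<bar>p i * (f i \<bullet> g i)\<bar> \<le> p i * (norm (f i) * norm (g i))"
      using p_ge[OF i] Cauchy_Schwarz_ineq2[of "f i" "g i"] by (simp add: abs_mult mult_left_mono)
    also have "\<dots> = (sqrt (p i) * sqrt (p i)) * (norm (f i) * norm (g i))"
      using p_ge[OF i] by simp
    also have "\<dots> = \<bar>sqrt (p i) * norm (f i)\<bar> * \<bar>sqrt (p i) * norm (g i)\<bar>"
      using p_ge[OF i] by (simp add: abs_mult del: real_sqrt_mult_self)
    finally show "\<bar>p i * (f i \<bullet> g i)\<bar> \<le> \<dots>" .
  qed
  then show ?thesis unfolding nrm_def by (rule order_trans[OF _ L2_set_mult_ineq])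
qed

lemma ip_le: "ip f g \<le> nrm f * nrm g"
  using abs_ip_le[of f g] by linarith

lemma nrm_le_scale:
  assumes "\<And>i. i \<in> V \<Longrightarrow> norm (f i) \<le> c * norm (g i)"
  shows "nrm f \<le> \<bar>c\<bar> * nrm g"
proof -
  have "nrm f \<le> L2_set (\<lambda>i. \<bar>c\<bar> * (sqrt (p i) * norm (g i))) V"
    unfolding nrm_def
  proof (rule L2_set_mono)
    fix i assume i: "i \<in> V"
    have "norm (f i) \<le> \<bar>c\<bar> * norm (g i)"
      by (rule order_trans[OF assms[OF i]]) (simp add: mult_right_mono)
    then show "sqrt (p i) * norm (f i) \<le> \<bar>c\<bar> * (sqrt (p i) * norm (g i))"
      using mult_left_mono[of "norm (f i)" "\<bar>c\<bar> * norm (g i)" "sqrt (p i)"] p_ge[OF i]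
      by (simp add: mult.left_commute)
  qed (simp add: p_ge)
  then show ?thesis by (simp add: nrm_def L2_set_right_distrib)
qed

lemma nrm_mono: "(\<And>i. i \<in> V \<Longrightarrow> norm (f i) \<le> norm (g i)) \<Longrightarrow> nrm f \<le> nrm g"
  using nrm_le_scale[of f 1 g] by simp

lemma nrm_triangle: "nrm (\<lambda>i. f i + g i) \<le> nrm f + nrm g"
proof -
  have "nrm (\<lambda>i. f i + g i) \<le> L2_set (\<lambda>i. sqrt (p i) * norm (f i) + sqrt (p i) * norm (g i)) V"
    unfolding nrm_def
    by (rule L2_set_mono) (auto simp: p_ge norm_triangle_ineq mult_left_mono simp flip: distrib_left)
  then show ?thesis unfolding nrm_def by (rule order_trans[OF _ L2_set_triangle_ineq])
qed

lemma nrm_minus [simp]: "nrm (\<lambda>i. - f i) = nrm f"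
  by (simp add: nrm_def)

lemma nrm_triangle_diff: "nrm (\<lambda>i. f i - g i) \<le> nrm f + nrm g"
  using nrm_triangle[of f "\<lambda>i. - g i"] by simp

lemma nrm_eq_0_iff: "nrm f = 0 \<longleftrightarrow> (\<forall>i\<in>V. f i = 0)"
  using finV p_pos by (fastforce simp: nrm_def L2_set_eq_0_iff)

lemma norm_le_nrm: "i \<in> V \<Longrightarrow> sqrt (p i) * norm (f i) \<le> nrm f"
  unfolding nrm_def using member_le_L2_set[OF finV, of i "\<lambda>i. sqrt (p i) * norm (f i)"] by simp

text \<open>For self-adjoint operators the numerical radius bounds the norm. Both \<open>H\<close>
  and \<open>contr\<close> are therefore estimated through their quadratic forms alone.\<close>

lemma nrm_symmetric_le:
  fixes N :: "('i \<Rightarrow> 'v::real_inner) \<Rightarrow> 'i \<Rightarrow> 'v"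
  assumes lin: "\<And>a b f h i. N (\<lambda>i. a *\<^sub>R f i + b *\<^sub>R h i) i = a *\<^sub>R N f i + b *\<^sub>R N h i"
    and sym: "\<And>f h. ip (N f) h = ip f (N h)"
    and q: "\<And>f. \<bar>ip (N f) f\<bar> \<le> \<theta> * (nrm f)\<^sup>2"
  shows "nrm (N f) \<le> \<theta> * nrm f"
proof (cases "nrm f = 0 \<or> nrm (N f) = 0")
  case True
  then show ?thesis
  proof
    assume *: "nrm f = 0"
    have "(nrm (N f))\<^sup>2 \<le> nrm f * nrm (N (N f))"
      unfolding nrm_power2 by (subst sym) (rule ip_le)
    with * show ?thesis by simp
  next
    assume *: "nrm (N f) = 0"
    have "0 \<le> \<theta> * nrm f * nrm f" using order_trans[OF abs_ge_zero q[of f]] by (simp add: power2_eq_square mult.assoc)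
    then show ?thesis using * nrm_ge_0[of f] by (auto simp: zero_le_mult_iff)
  qed
next
  case False
  define a b where "a = nrm f" and "b = nrm (N f)"
  have pos: "a > 0" "b > 0" using False by (simp_all add: a_def b_def less_le)
  define t where "t = a / b"
  have t: "t > 0" using pos by (simp add: t_def)
  \<comment> \<open>Polarization of \<open>ip (N f) h\<close>; this \<open>t\<close> balances the norms of \<open>f\<close> and \<open>h\<close>.\<close>
  define h where "h = (\<lambda>i. t *\<^sub>R N f i)"
  have l1: "N (\<lambda>i. f i + h i) = (\<lambda>i. N f i + N h i)" using lin[of 1 f 1 h] by auto
  have l2: "N (\<lambda>i. f i - h i) = (\<lambda>i. N f i - N h i)" using lin[of 1 f "-1" h] by auto
  have s: "ip (N h) f = ip (N f) h" using sym[of h f] ip_commute[of h "N f"] by simp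
  have "4 * ip (N f) h = ip (N (\<lambda>i. f i + h i)) (\<lambda>i. f i + h i) - ip (N (\<lambda>i. f i - h i)) (\<lambda>i. f i - h i)"
    unfolding l1 l2 by (simp add: ip_simps s)
  also have "\<dots> \<le> \<theta> * (nrm (\<lambda>i. f i + h i))\<^sup>2 + \<theta> * (nrm (\<lambda>i. f i - h i))\<^sup>2"
    using q[of "\<lambda>i. f i + h i"] q[of "\<lambda>i. f i - h i"] by linarith
  also have "\<dots> = 2 * \<theta> * (ip f f + ip h h)"
    by (simp add: nrm_power2 ip_simps ip_commute algebra_simps)
  finally have "4 * (t * b\<^sup>2) \<le> 2 * \<theta> * (a\<^sup>2 + t\<^sup>2 * b\<^sup>2)"
    by (simp add: h_def ip_simps a_def b_def nrm_power2 power2_eq_square[of t] mult.assoc)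
  moreover have "t * b\<^sup>2 = a * b" "t\<^sup>2 * b\<^sup>2 = a\<^sup>2" using pos by (simp_all add: t_def power2_eq_square)
  ultimately have "4 * (a * b) \<le> 2 * \<theta> * (a\<^sup>2 + a\<^sup>2)" by simp
  then have "4 * (a * b) \<le> 4 * (a * (\<theta> * a))" by (simp add: power2_eq_square algebra_simps)
  then show ?thesis using pos by (simp add: a_def b_def)
qed

end

text \<open>In \<open>band\<close> the width \<open>w\<close> is an integer, so that w = -1 can say
  that f vanishes on \<open>V\<close>; the induction in \<open>near_support\<close> starts from this
  value.\<close>

locale banded_symmetric_operator = weighted_space V p
  for V :: "'i set" and p +
  fixes H :: "('i \<Rightarrow> 'v::euclidean_space) \<Rightarrow> 'i \<Rightarrow> 'v" and dep :: "'i \<Rightarrow> nat" and M g :: real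
  assumes lin: "H (\<lambda>i. a *\<^sub>R f i + b *\<^sub>R h i) i = a *\<^sub>R H f i + b *\<^sub>R H h i"
    and sym: "ip (H f) h = ip f (H h)"
    and form_le: "\<bar>ip (H f) f\<bar> \<le> M * (nrm f)\<^sup>2"
    and lower: "g * nrm f \<le> nrm (H f)"
    and g: "0 < g" "g < M"
    and band: "(\<And>i. i \<in> V \<Longrightarrow> f i \<noteq> 0 \<Longrightarrow> \<bar>int (dep i) - m\<bar> \<le> w) \<Longrightarrow>
      i \<in> V \<Longrightarrow> H f i \<noteq> 0 \<Longrightarrow> \<bar>int (dep i) - m\<bar> \<le> w + 1"
begin

text \<open>The step for which 1 - c s runs from \<open>theta\<close> at
  \<open>s = g\<^sup>2\<close> to -\<open>theta\<close> at \<open>s = M\<^sup>2\<close>, the best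
  balance over this interval.\<close>

definition c :: real where "c = 2 / (M\<^sup>2 + g\<^sup>2)"
definition theta :: real where "theta = (M\<^sup>2 - g\<^sup>2) / (M\<^sup>2 + g\<^sup>2)"
definition contr :: "('i \<Rightarrow> 'v) \<Rightarrow> 'i \<Rightarrow> 'v" where "contr f i = f i - c *\<^sub>R H (H f) i"

lemma H_diff: "H (\<lambda>i. f i - h i) = (\<lambda>i. H f i - H h i)"
  using lin[of 1 f "-1" h] by auto

lemma H_scale: "H (\<lambda>i. a *\<^sub>R f i) = (\<lambda>i. a *\<^sub>R H f i)"
  using lin[of a f 0 f] by auto

lemma H_add: "H (\<lambda>i. f i + h i) = (\<lambda>i. H f i + H h i)"
  using lin[of 1 f 1 h] by auto

lemma sq_pos: "M\<^sup>2 + g\<^sup>2 > 0" "g\<^sup>2 < M\<^sup>2"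
  using g by (auto intro: add_pos_pos power_strict_mono)

lemma theta: "0 < theta" "theta < 1"
  using sq_pos g by (simp_all add: theta_def)

lemma nrm_H: "nrm (H f) \<le> M * nrm f"
  by (rule nrm_symmetric_le[OF lin sym form_le])

lemma theta_eq: "theta = 1 - c * g\<^sup>2" "theta = c * M\<^sup>2 - 1"
proof -
  define s where "s = M\<^sup>2 + g\<^sup>2"
  have s: "s > 0" "g\<^sup>2 = s - M\<^sup>2" "theta = (M\<^sup>2 - g\<^sup>2) / s" "c = 2 / s"
    using sq_pos by (simp_all add: s_def theta_def c_def)
  show "theta = 1 - c * g\<^sup>2" "theta = c * M\<^sup>2 - 1"
    unfolding s(3,4) using s(1) by (simp_all add: s(2) field_simps)
qed

text \<open>The form of \<open>contr\<close> at f is |f|^2 - c |H f|^2, so the lower and upper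
  bounds for \<open>H\<close> give the two sides of the estimate.\<close>

lemma nrm_contr: "nrm (contr f) \<le> theta * nrm f"
proof (rule nrm_symmetric_le)
  show "contr (\<lambda>i. a *\<^sub>R f i + b *\<^sub>R h i) i = a *\<^sub>R contr f i + b *\<^sub>R contr h i" for a b f h i
    by (simp add: contr_def H_add H_scale algebra_simps)
  have contr_eq: "contr f = (\<lambda>i. f i - c *\<^sub>R H (H f) i)" for f by (simp add: contr_def fun_eq_iff)
  show "ip (contr f) h = ip f (contr h)" for f h
    by (simp add: contr_eq ip_simps sym)
  show "\<bar>ip (contr f) f\<bar> \<le> theta * (nrm f)\<^sup>2" for f
  proof -
    have eq: "ip (contr f) f = (nrm f)\<^sup>2 - c * (nrm (H f))\<^sup>2"
      by (simp add: contr_eq ip_simps nrm_power2 sym)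
    have c0: "0 < c" using sq_pos by (simp add: c_def)
    have "(g * nrm f)\<^sup>2 \<le> (nrm (H f))\<^sup>2" using lower[of f] g by (intro power_mono) auto
    then have 1: "c * (g\<^sup>2 * (nrm f)\<^sup>2) \<le> c * (nrm (H f))\<^sup>2" using c0 by (simp add: power_mult_distrib)
    have "(nrm (H f))\<^sup>2 \<le> (M * nrm f)\<^sup>2" using nrm_H[of f] by (intro power_mono) auto
    then have 2: "c * (nrm (H f))\<^sup>2 \<le> c * (M\<^sup>2 * (nrm f)\<^sup>2)" using c0 by (simp add: power_mult_distrib)
    have e1: "(nrm f)\<^sup>2 - c * (g\<^sup>2 * (nrm f)\<^sup>2) = theta * (nrm f)\<^sup>2"
      and e2: "c * (M\<^sup>2 * (nrm f)\<^sup>2) - (nrm f)\<^sup>2 = theta * (nrm f)\<^sup>2"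
      by (subst theta_eq(1), simp add: left_diff_distrib mult.assoc)
        (subst theta_eq(2), simp add: left_diff_distrib mult.assoc)
    show ?thesis unfolding eq using 1 2 e1 e2 by linarith
  qed
qed

lemma nrm_contr_pow: "nrm ((contr ^^ n) f) \<le> theta ^ n * nrm f"
proof (induction n)
  case (Suc n)
  have "nrm (contr ((contr ^^ n) f)) \<le> theta * nrm ((contr ^^ n) f)" by (rule nrm_contr)
  also have "\<dots> \<le> theta * (theta ^ n * nrm f)" using theta Suc by (intro mult_left_mono) auto
  finally show ?case by simp
qed simp

lemma solution_unique:
  assumes "\<And>i. i \<in> V \<Longrightarrow> H f i = H h i" "i \<in> V"
  shows "f i = h i"
proof -
  have "nrm (H (\<lambda>i. f i - h i)) = 0" using assms(1) by (simp add: H_diff nrm_eq_0_iff)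
  then have "g * nrm (\<lambda>i. f i - h i) \<le> 0" using lower[of "\<lambda>i. f i - h i"] by simp
  then have "nrm (\<lambda>i. f i - h i) = 0" using g nrm_ge_0[of "\<lambda>i. f i - h i"] by (simp add: mult_le_0_iff)
  then show ?thesis using assms(2) by (simp add: nrm_eq_0_iff)
qed

lemma solution_exists: "\<exists>z. \<forall>i\<in>V. H z i = v i"
proof -
  \<comment> \<open>\<open>z\<close> is the Neumann series for \<open>H\<^sup>2 z = H v\<close>; injectivity of \<open>H\<close> then gives \<open>H z = v\<close>.\<close>
  define e where "e n = (contr ^^ n) (\<lambda>i. c *\<^sub>R H v i)" for n
  define S where "S n = (\<lambda>i. \<Sum>m<n. e m i)" for n
  define z where "z = (\<lambda>i. \<Sum>m. e m i)"
  define C where "C = nrm (e 0)"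
  have c0: "c > 0" using sq_pos by (simp add: c_def)
  have en: "nrm (e n) \<le> theta ^ n * C" for n
    using nrm_contr_pow[of n] by (simp add: e_def C_def)
  have geo: "(\<lambda>n. theta ^ n * C) \<longlonglongrightarrow> 0" using theta by (auto intro!: tendsto_mult_left_zero LIMSEQ_power_zero)
  have Sz: "(\<lambda>n. S n i) \<longlonglongrightarrow> z i" if i: "i \<in> V" for i
    unfolding S_def z_def
  proof (rule summable_LIMSEQ, rule summable_comparison_test'[where N=0])
    show "summable (\<lambda>n. theta ^ n * (C / sqrt (p i)))" using theta by (intro summable_mult2 summable_geometric) auto
    show "norm (e n i) \<le> theta ^ n * (C / sqrt (p i))" for n
      using order_trans[OF norm_le_nrm[OF i] en[of n]] p_pos[OF i] by (simp add: field_simps)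
  qed
  have HHS: "c *\<^sub>R H (H (S n)) i = e 0 i - e n i" for n i
  proof (induction n arbitrary: i)
    case 0
    have "H (\<lambda>_. 0) = (\<lambda>_. 0)" using H_scale[of 0 "\<lambda>_. 0"] by simp
    then show ?case by (simp add: S_def)
  next
    case (Suc n)
    have "S (Suc n) = (\<lambda>i. S n i + e n i)" by (simp add: S_def)
    then have "c *\<^sub>R H (H (S (Suc n))) i = e 0 i - e n i + c *\<^sub>R H (H (e n)) i"
      by (simp add: H_add scaleR_add_right Suc)
    also have "e (Suc n) i = e n i - c *\<^sub>R H (H (e n)) i" by (simp add: e_def contr_def[of "(contr ^^ n) _"])
    then have "e 0 i - e n i + c *\<^sub>R H (H (e n)) i = e 0 i - e (Suc n) i" by simp
    finally show ?case .
  qed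
  \<comment> \<open>\<open>H\<close> maps c (H (S n) - v) to minus the n-th term of the series, so
    the lower bound for \<open>H\<close> turns decay of the terms into convergence of H (S n) to
    v.\<close>
  have HS: "nrm (\<lambda>i. H (S n) i - v i) \<le> theta ^ n * C / (c * g)" for n
  proof -
    have "(\<lambda>i. c *\<^sub>R H (\<lambda>i. H (S n) i - v i) i) = (\<lambda>i. - e n i)"
      using HHS[of n] by (simp add: H_diff scaleR_diff_right fun_eq_iff) (simp add: e_def)
    then have "nrm (H (\<lambda>i. c *\<^sub>R (H (S n) i - v i))) = nrm (e n)"
      by (simp add: H_scale)
    then have "g * nrm (\<lambda>i. c *\<^sub>R (H (S n) i - v i)) \<le> theta ^ n * C"
      using lower[of "\<lambda>i. c *\<^sub>R (H (S n) i - v i)"] en[of n] by simp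
    moreover have "c * nrm (\<lambda>i. H (S n) i - v i) = nrm (\<lambda>i. c *\<^sub>R (H (S n) i - v i))"
      using c0 unfolding nrm_def by (simp add: L2_set_right_distrib mult.left_commute)
    ultimately show ?thesis using g c0 by (simp add: field_simps)
  qed
  have "(\<lambda>n. nrm (\<lambda>i. z i - S n i)) \<longlonglongrightarrow> nrm (\<lambda>i. z i - z i)"
    unfolding nrm_def L2_set_def by (intro tendsto_intros Sz)
  moreover have "nrm (\<lambda>i. z i - z i) = 0" by (simp add: nrm_eq_0_iff)
  ultimately have nz: "(\<lambda>n. nrm (\<lambda>i. z i - S n i)) \<longlonglongrightarrow> 0" by simp
  have "(\<lambda>n. M * nrm (\<lambda>i. z i - S n i) + theta ^ n * C / (c * g)) \<longlonglongrightarrow> M * 0 + 0 / (c * g)"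
    using g c0 by (intro tendsto_intros geo nz) auto
  moreover have "nrm (\<lambda>i. H z i - v i) \<le> M * nrm (\<lambda>i. z i - S n i) + theta ^ n * C / (c * g)" for n
    using nrm_triangle[of "H (\<lambda>i. z i - S n i)" "\<lambda>i. H (S n) i - v i"] nrm_H[of "\<lambda>i. z i - S n i"] HS[of n]
    by (simp add: H_diff)
  ultimately have "nrm (\<lambda>i. H z i - v i) \<le> M * 0 + 0 / (c * g)"
    by (intro LIMSEQ_le_const[where a="nrm (\<lambda>i. H z i - v i)"]) blast+
  then have "nrm (\<lambda>i. H z i - v i) = 0" using nrm_ge_0[of "\<lambda>i. H z i - v i"] by simp
  then show ?thesis by (auto simp: nrm_eq_0_iff)
qed

text \<open>Write e for the n-th iterate and D = z - e. Then H e = v - H D, where v lives on stage m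
  and \<open>H\<close> widens the support of D by one stage. The next iterate differs from e by a
  multiple of H (H e), which widens it by one more.\<close>

lemma near_support:
  assumes z: "\<And>i. i \<in> V \<Longrightarrow> H z i = v i"
    and v: "\<And>i. i \<in> V \<Longrightarrow> v i \<noteq> 0 \<Longrightarrow> dep i = m"
    and "i \<in> V" "z i \<noteq> (contr ^^ n) z i"
  shows "\<bar>int (dep i) - int m\<bar> \<le> 2 * int n - 1"
  using assms(3,4)
proof (induction n arbitrary: i)
  case (Suc n)
  define e where "e = (contr ^^ n) z"
  define D where "D = (\<lambda>i. z i - e i)"
  have 1: "\<bar>int (dep i) - int m\<bar> \<le> 2 * int n" if "i \<in> V" "H D i \<noteq> 0" for i
    using band[of D "int m" "2 * int n - 1" i] Suc.IH that by (auto simp: D_def e_def)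
  have "H e i = v i - H D i" if "i \<in> V" for i using z[OF that] by (simp add: D_def H_diff)
  then have 2: "\<bar>int (dep i) - int m\<bar> \<le> 2 * int n" if "i \<in> V" "H e i \<noteq> 0" for i
    using 1[of i] v[of i] that by force
  show ?case
  proof (cases "D i = 0")
    case True
    moreover have "(contr ^^ Suc n) z i = e i - c *\<^sub>R H (H e) i" by (simp add: e_def contr_def[of "(contr ^^ n) z"])
    ultimately have "H (H e) i \<noteq> 0" using Suc.prems(2) by (auto simp: D_def)
    then show ?thesis using band[of "H e" "int m" "2 * int n" i] 2 Suc.prems(1) by auto
  next
    case False
    then show ?thesis using Suc.IH[OF Suc.prems(1)] by (auto simp: D_def e_def)
  qed
qed simp

lemma solution_decay:
  assumes z: "\<And>i. i \<in> V \<Longrightarrow> H z i = v i"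
    and v: "\<And>i. i \<in> V \<Longrightarrow> v i \<noteq> 0 \<Longrightarrow> dep i = m"
  shows "sqrt (\<Sum>i\<in>{i\<in>V. dep i = t}. p i * (norm (z i))\<^sup>2)
    \<le> M / (g\<^sup>2 * sqrt theta) * sqrt theta ^ (if t \<le> m then m - t else t - m) * nrm v"
proof -
  define l where "l = (if t \<le> m then m - t else t - m)"
  define n where "n = l div 2"
  define e where "e = (contr ^^ n) z"
  have ln: "2 * n \<le> l" "l \<le> 2 * n + 1" by (auto simp: n_def)
  have ze: "z i = e i" if "i \<in> V" "dep i = t" for i
    using near_support[OF z v, of i n] that ln by (force simp: l_def e_def split: if_splits)
  have "(\<Sum>i\<in>{i\<in>V. dep i = t}. p i * (norm (z i))\<^sup>2) = (\<Sum>i\<in>{i\<in>V. dep i = t}. p i * (norm (e i))\<^sup>2)"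
    using ze by simp
  also have "\<dots> \<le> (nrm e)\<^sup>2" unfolding nrm_power2_sum
    using finV by (intro sum_mono2) (auto simp: p_ge)
  finally have "sqrt (\<Sum>i\<in>{i\<in>V. dep i = t}. p i * (norm (z i))\<^sup>2) \<le> nrm e"
    by (simp add: real_le_lsqrt)
  also have "\<dots> \<le> theta ^ n * nrm z" unfolding e_def by (rule nrm_contr_pow)
  also have "nrm z \<le> nrm v / g"
    using lower[of z] g nrm_cong[of "H z" v] z by (simp add: field_simps)
  then have "theta ^ n * nrm z \<le> theta ^ n * (nrm v / g)" using theta by (intro mult_left_mono) auto
  \<comment> \<open>Rounding an odd distance down to 2 n costs one factor \<open>sqrt theta\<close>,
    and 1/g is relaxed to \<open>M / g\<^sup>2\<close>; this produces the shape of
    \<open>c_1\<close>.\<close>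
  also have "\<dots> \<le> sqrt theta ^ l / sqrt theta * (M / g\<^sup>2 * nrm v)"
  proof (rule mult_mono)
    have "theta ^ n * sqrt theta = sqrt theta ^ (2 * n + 1)"
      using theta by (simp add: power_mult)
    also have "\<dots> \<le> sqrt theta ^ l" using ln theta by (intro power_decreasing) auto
    finally show "theta ^ n \<le> sqrt theta ^ l / sqrt theta" using theta by (simp add: field_simps)
    have "1 / g \<le> M / g\<^sup>2" using g by (simp add: field_simps power2_eq_square)
    then show "nrm v / g \<le> M / g\<^sup>2 * nrm v" using mult_right_mono[OF _ nrm_ge_0[of v]] by fastforce
  qed (use theta g in auto)
  finally show ?thesis by (simp add: l_def field_simps)
qed

end

subsection \<open>Weighted trees\<close>

context weighted_space
begin

lemma ip_Pair: "ip (\<lambda>i. (f i, g i)) (\<lambda>i. (f' i, g' i)) = ip f f' + ip g g'"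
  by (simp add: ip_def distrib_left sum.distrib)

lemma nrm_Pair_power2: "(nrm (\<lambda>i. (f i, g i)))\<^sup>2 = (nrm f)\<^sup>2 + (nrm g)\<^sup>2"
  by (simp add: nrm_power2_sum norm_Pair distrib_left sum.distrib)

lemma nrm_Pair_le: "nrm (\<lambda>i. (f i, g i)) \<le> nrm f + nrm g"
proof -
  have "(nrm (\<lambda>i. (f i, g i)))\<^sup>2 \<le> (nrm f + nrm g)\<^sup>2"
    unfolding nrm_Pair_power2 by (simp add: power2_sum)
  then show ?thesis by (rule power2_le_imp_le) simp
qed

text \<open>Brezzi's splitting w = w0 + w1: the right inverse supplies w1 with the same F-value as
  w, so w0 lies in the kernel of F. Testing the first residual with w0 eliminates y and coercivity
  bounds w0. Testing it with a preimage of y under F then bounds y.\<close>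

lemma saddle_point_lower_bound:
  fixes F :: "('i \<Rightarrow> 'w::real_inner) \<Rightarrow> 'i \<Rightarrow> 'y::real_inner"
  assumes F_diff: "\<And>w w' i. F (\<lambda>i. w i - w' i) i = F w i - F w' i"
    and G_diff: "\<And>w w' i. G (\<lambda>i. w i - w' i) i = G w i - G w' i"
    and adj: "\<And>w y. ip (F w) y = ip w (Fa y)"
    and G_le: "\<And>w. nrm (G w) \<le> L * nrm w"
    and coercive: "\<And>w. (\<And>i. i \<in> V \<Longrightarrow> F w i = 0) \<Longrightarrow> \<sigma> * (nrm w)\<^sup>2 \<le> ip w (G w)"
    and right_inv: "\<And>b. \<exists>w. (\<forall>i\<in>V. F w i = b i) \<and> nrm w \<le> \<kappa> * nrm b"
    and pos: "0 < \<sigma>" "0 \<le> L"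
    and a: "nrm (\<lambda>i. G w i - Fa y i) \<le> e" and b: "nrm (F w) \<le> e" and \<kappa>: "0 \<le> \<kappa>"
  shows "nrm w + nrm y \<le> ((1 + \<kappa> * L) * ((1 + L * \<kappa>) / \<sigma> + \<kappa>) + \<kappa>) * e"
proof -
  obtain w1 where w1: "\<And>i. i \<in> V \<Longrightarrow> F w1 i = F w i" and "nrm w1 \<le> \<kappa> * nrm (F w)"
    using right_inv[of "F w"] by blast
  then have nw1: "nrm w1 \<le> \<kappa> * e" using mult_left_mono[OF b \<kappa>] by linarith
  define w0 where "w0 = (\<lambda>i. w i - w1 i)"
  have F0: "F w0 i = 0" if "i \<in> V" for i using w1[OF that] by (simp add: w0_def F_diff)
  have nw0: "nrm w0 \<le> (e + L * (\<kappa> * e)) / \<sigma>"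
  proof (cases "nrm w0 = 0")
    case False
    have "ip w0 (Fa y) = 0" unfolding adj[symmetric] by (simp add: ip_def F0)
    moreover have "G w0 = (\<lambda>i. G w i - G w1 i)" by (simp add: w0_def G_diff fun_eq_iff)
    ultimately have "ip w0 (G w0) = ip w0 (\<lambda>i. G w i - Fa y i) - ip w0 (G w1)"
      by (simp add: ip_simps)
    also have "\<dots> \<le> nrm w0 * e + nrm w0 * (L * (\<kappa> * e))"
    proof -
      have "ip w0 (\<lambda>i. G w i - Fa y i) \<le> nrm w0 * e"
        by (rule order_trans[OF ip_le]) (simp add: a mult_left_mono)
      moreover have "nrm (G w1) \<le> L * (\<kappa> * e)"
        using G_le[of w1] mult_left_mono[OF nw1 pos(2)] by linarith
      then have "\<bar>ip w0 (G w1)\<bar> \<le> nrm w0 * (L * (\<kappa> * e))"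
        by (intro order_trans[OF abs_ip_le] mult_left_mono) simp_all
      ultimately show ?thesis by linarith
    qed
    finally have "nrm w0 * (\<sigma> * nrm w0) \<le> nrm w0 * (e + L * (\<kappa> * e))"
      using coercive[OF F0] by (simp add: power2_eq_square algebra_simps)
    moreover have "0 < nrm w0" using False nrm_ge_0[of w0] by linarith
    ultimately have "\<sigma> * nrm w0 \<le> e + L * (\<kappa> * e)" by (simp only: mult_le_cancel_left_pos)
    then show ?thesis using pos by (simp add: pos_le_divide_eq mult.commute)
  qed (use pos \<kappa> order_trans[OF nrm_ge_0 b] in simp)
  have w_eq: "w = (\<lambda>i. w0 i + w1 i)" by (simp add: w0_def)
  have nw: "nrm w \<le> ((1 + L * \<kappa>) / \<sigma> + \<kappa>) * e"
    using nrm_triangle[of w0 w1] nw0 nw1 unfolding w_eq[symmetric]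
    by (simp add: algebra_simps add_divide_distrib)
  obtain w2 where w2: "\<And>i. i \<in> V \<Longrightarrow> F w2 i = y i" "nrm w2 \<le> \<kappa> * nrm y"
    using right_inv[of y] by blast
  have ny: "nrm y \<le> \<kappa> * (L * nrm w + e)"
  proof (cases "nrm y = 0")
    case False
    have "(nrm y)\<^sup>2 = ip (F w2) y" unfolding nrm_power2 using w2 by (simp add: ip_def)
    also have "\<dots> = ip w2 (\<lambda>i. G w i - (G w i - Fa y i))" by (simp add: adj)
    also have "\<dots> \<le> nrm w2 * (nrm (G w) + nrm (\<lambda>i. G w i - Fa y i))"
      by (intro order_trans[OF ip_le] mult_left_mono nrm_triangle_diff) simp
    also have "\<dots> \<le> (\<kappa> * nrm y) * (L * nrm w + e)"
      using w2 G_le[of w] a \<kappa> by (intro mult_mono add_mono add_nonneg_nonneg) auto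
    finally have "nrm y * nrm y \<le> nrm y * (\<kappa> * (L * nrm w + e))"
      by (simp add: power2_eq_square algebra_simps)
    moreover have "0 < nrm y" using False nrm_ge_0[of y] by linarith
    ultimately show ?thesis by simp
  qed (use \<kappa> pos order_trans[OF nrm_ge_0 b] in simp)
  have "nrm w + nrm y \<le> (1 + \<kappa> * L) * nrm w + \<kappa> * e" using ny by (simp add: algebra_simps)
  also have "\<dots> \<le> (1 + \<kappa> * L) * (((1 + L * \<kappa>) / \<sigma> + \<kappa>) * e) + \<kappa> * e"
    using nw \<kappa> pos by (intro add_right_mono mult_left_mono) auto
  finally show ?thesis by (simp add: algebra_simps)
qed

end

text \<open>The transition matrix to i from its s-th ancestor. It is built upwards from i, because
  the path to an ancestor is unique while paths downwards branch.\<close>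

primrec path_prod :: "('i \<Rightarrow> 'i) \<Rightarrow> ('i \<Rightarrow> real^'n^'n) \<Rightarrow> nat \<Rightarrow> 'i \<Rightarrow> real^'n^'n" where
  "path_prod par \<Phi> 0 i = mat 1"
| "path_prod par \<Phi> (Suc s) i = \<Phi> i ** path_prod par \<Phi> s (par i)"

text \<open>\<open>mass\<close> is an inequality because nodes at the last stage of a window have no
  children inside it.\<close>

locale weighted_tree = weighted_space V p for V :: "'i set" and p +
  fixes k :: 'i and par :: "'i \<Rightarrow> 'i" and dep :: "'i \<Rightarrow> nat"
  assumes root: "k \<in> V"
    and par_in: "i \<in> V \<Longrightarrow> i \<noteq> k \<Longrightarrow> par i \<in> V"
    and dep_root: "dep k = 0"
    and dep_par: "i \<in> V \<Longrightarrow> i \<noteq> k \<Longrightarrow> dep i = Suc (dep (par i))"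
    and mass: "i \<in> V \<Longrightarrow> (\<Sum>j\<in>{j\<in>V. j \<noteq> k \<and> par j = i}. p j) \<le> p i"
begin

definition ch :: "'i \<Rightarrow> 'i set" where "ch i = {j\<in>V. j \<noteq> k \<and> par j = i}"

text \<open>The value 0 at the root encodes the zero predecessor in EP(k, W, 0).\<close>

definition sh :: "('i \<Rightarrow> 'v::zero) \<Rightarrow> 'i \<Rightarrow> 'v" where "sh f i = (if i = k then 0 else f (par i))"

lemma sum_children: "(\<Sum>j\<in>V - {k}. \<phi> j (par j)) = (\<Sum>i\<in>V. \<Sum>j\<in>ch i. \<phi> j i)"
proof -
  have "(\<Sum>i\<in>V. \<Sum>j\<in>ch i. \<phi> j i) = (\<Sum>i\<in>V. \<Sum>j\<in>{j. j \<in> V - {k} \<and> par j = i}. \<phi> j (par j))"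
    by (intro sum.cong) (auto simp: ch_def)
  also have "\<dots> = (\<Sum>j\<in>V - {k}. \<phi> j (par j))"
    using finV par_in by (intro sum.group) auto
  finally show ?thesis by simp
qed

text \<open>Grouping by parents gives each node the total mass of its children as weight. In an
  unweighted norm the branching number would appear here.\<close>

lemma nrm_sh: "nrm (sh f) \<le> nrm f"
proof -
  have "(nrm (sh f))\<^sup>2 = (\<Sum>j\<in>V - {k}. p j * (norm (f (par j)))\<^sup>2)"
    unfolding nrm_power2_sum using finV by (intro sum.mono_neutral_cong_right) (auto simp: sh_def)
  also have "\<dots> = (\<Sum>i\<in>V. (\<Sum>j\<in>ch i. p j) * (norm (f i))\<^sup>2)"
    using sum_children[of "\<lambda>j i. p j * (norm (f i))\<^sup>2"] by (simp add: sum_distrib_right)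
  also have "\<dots> \<le> (nrm f)\<^sup>2"
    unfolding nrm_power2_sum using mass by (intro sum_mono mult_right_mono) (auto simp: ch_def)
  finally show ?thesis by (rule power2_le_imp_le) simp
qed

text \<open>The majorant h satisfies h = C |v| + \<alpha> sh h on \<open>V\<close>, so
  nonexpansiveness of \<open>sh\<close> gives |h| \<le> C |v| + \<alpha> |h|, without any exchange
  of sums.\<close>

lemma nrm_discounted:
  assumes \<alpha>: "0 \<le> \<alpha>" "\<alpha> < 1" and C: "0 \<le> C"
    and x: "\<And>i. i \<in> V \<Longrightarrow> norm (x i) \<le> (\<Sum>s\<le>dep i. C * \<alpha> ^ s * norm (v ((par ^^ s) i)))"
  shows "nrm x \<le> C / (1 - \<alpha>) * nrm v"
proof -
  define h :: "'i \<Rightarrow> real" where "h i = (\<Sum>s\<le>dep i. C * \<alpha> ^ s * norm (v ((par ^^ s) i)))" for i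
  have h: "h i = C * norm (v i) + \<alpha> * sh h i" if "i \<in> V" for i
    using dep_par[OF that] dep_root
    by (cases "i = k") (simp_all add: h_def sh_def sum.atMost_Suc_shift sum_distrib_left funpow_swap1
        mult_ac del: sum.atMost_Suc)
  have "nrm h = nrm (\<lambda>i. C * norm (v i) + \<alpha> * sh h i)" by (rule nrm_cong) (rule h)
  also have "\<dots> \<le> nrm (\<lambda>i. C * norm (v i)) + nrm (\<lambda>i. \<alpha> * sh h i)" by (rule nrm_triangle)
  also have "nrm (\<lambda>i. C * norm (v i)) \<le> C * nrm v"
    using nrm_le_scale[of "\<lambda>i. C * norm (v i)" C v] C by simp
  also have "nrm (\<lambda>i. \<alpha> * sh h i) \<le> \<alpha> * nrm h"
    using nrm_le_scale[of "\<lambda>i. \<alpha> * sh h i" \<alpha> "sh h"] \<alpha> mult_left_mono[OF nrm_sh[of h]]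
    by (fastforce simp: abs_mult)
  finally have "nrm h \<le> C / (1 - \<alpha>) * nrm v" using \<alpha> by (simp add: field_simps)
  moreover have "nrm x \<le> nrm h"
  proof (rule nrm_mono)
    show "norm (x i) \<le> norm (h i)" if "i \<in> V" for i using x[OF that] by (simp add: h_def)
  qed
  ultimately show ?thesis by linarith
qed

text \<open>Variation of constants for the recursion x i = \<Phi> i (x at the parent) + v i.\<close>

definition path_sum :: "('i \<Rightarrow> real^'n^'n) \<Rightarrow> ('i \<Rightarrow> real^'n) \<Rightarrow> 'i \<Rightarrow> real^'n" where
  "path_sum \<Phi> v i = (\<Sum>s\<le>dep i. path_prod par \<Phi> s i *v v ((par ^^ s) i))"

lemma path_sum_rec: "i \<in> V \<Longrightarrow> path_sum \<Phi> v i = \<Phi> i *v sh (path_sum \<Phi> v) i + v i"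
  using dep_root dep_par[of i]
  by (cases "i = k") (simp_all add: path_sum_def sh_def sum.atMost_Suc_shift funpow_swap1
      linear_sum[OF matrix_vector_mul_linear] matrix_vector_mul_assoc del: sum.atMost_Suc)

lemma path_sum_unique:
  assumes x: "\<And>i. i \<in> V \<Longrightarrow> x i = \<Phi> i *v sh x i + v i" and "i \<in> V"
  shows "x i = path_sum \<Phi> v i"
  using assms(2)
proof (induction "dep i" arbitrary: i)
  case 0
  then have "i = k" using dep_par by fastforce
  then have "sh x i = sh (path_sum \<Phi> v) i" by (simp add: sh_def)
  then show ?case using x[OF 0(2)] path_sum_rec[OF 0(2), of \<Phi> v] by metis
next
  case (Suc n)
  then have "i \<noteq> k" using dep_root by auto
  then have "sh x i = sh (path_sum \<Phi> v) i" using Suc par_in dep_par[of i] by (simp add: sh_def)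
  then show ?case using x[OF Suc(3)] path_sum_rec[OF Suc(3), of \<Phi> v] by metis
qed

lemma nrm_recursion:
  assumes \<alpha>: "0 \<le> \<alpha>" "\<alpha> < 1" and C: "0 \<le> C"
    and x: "\<And>i. i \<in> V \<Longrightarrow> x i = \<Phi> i *v sh x i + v i"
    and decay: "\<And>i s. i \<in> V \<Longrightarrow> s \<le> dep i \<Longrightarrow> opnorm (path_prod par \<Phi> s i) \<le> C * \<alpha> ^ s"
  shows "nrm x \<le> C / (1 - \<alpha>) * nrm v"
proof (rule nrm_discounted[OF \<alpha> C])
  fix i assume i: "i \<in> V"
  have "x i = path_sum \<Phi> v i" using x i by (rule path_sum_unique)
  then show "norm (x i) \<le> (\<Sum>s\<le>dep i. C * \<alpha> ^ s * norm (v ((par ^^ s) i)))"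
    unfolding path_sum_def
    using decay[OF i]
    by (auto intro!: order_trans[OF norm_sum sum_mono] order_trans[OF norm_matrix_vector_le_opnorm] mult_right_mono)
qed

text \<open>A sum over edges can be grouped by parents; the ratio p j / p i, the conditional
  probability of a child in the scenario tree, corrects the change of weight.\<close>

lemma ip_sh_adjoint:
  fixes C :: "'i \<Rightarrow> real^'n^'m"
  shows "ip (\<lambda>i. C i *v sh f i) y = ip f (\<lambda>i. \<Sum>j\<in>ch i. (p j / p i) *\<^sub>R (transpose (C j) *v y j))"
proof -
  have "ip (\<lambda>i. C i *v sh f i) y = (\<Sum>j\<in>V - {k}. p j * (f (par j) \<bullet> (transpose (C j) *v y j)))"
    unfolding ip_def using finV
    by (intro sum.mono_neutral_cong_right) (auto simp: sh_def inner_transpose_matrix)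
  also have "\<dots> = (\<Sum>i\<in>V. \<Sum>j\<in>ch i. p j * (f i \<bullet> (transpose (C j) *v y j)))"
    by (rule sum_children)
  also have "\<dots> = ip f (\<lambda>i. \<Sum>j\<in>ch i. (p j / p i) *\<^sub>R (transpose (C j) *v y j))"
    unfolding ip_def using p_pos
    by (intro sum.cong) (auto simp: inner_sum_right sum_distrib_left less_imp_neq[symmetric] intro!: sum.cong)
  finally show ?thesis .
qed

lemma sh_lin: "sh (\<lambda>i. a *\<^sub>R f i + b *\<^sub>R h i) i = a *\<^sub>R sh f i + b *\<^sub>R sh h i"
  for f h :: "'i \<Rightarrow> 'v::real_vector"
  by (simp add: sh_def)

end

subsection \<open>The KKT operator of a linear-quadratic problem on a tree\<close>

text \<open>With h = 1 / \<open>gamma_G\<close> and M = \<open>L_H L\<close>, the quantities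
  \<kappa>, h, M are all at least 1. The left side of the last claim is at most \<kappa>^2 h (L^2 +
  3 L + 3), hence at most 4 M^3 \<kappa>^2 h^2, which is a single term of the expanded inverse of
  \<open>gamma_H\<close>; the other terms are nonnegative.\<close>

lemma gamma_H_bounds:
  assumes L: "1 \<le> L" and \<alpha>: "0 < \<alpha>" "\<alpha> < 1" and \<gamma>: "0 < \<gamma>" "\<gamma> \<le> 1"
    and \<kappa>: "\<kappa> = (1 + L) * L / (1 - \<alpha>)"
  shows "0 < gamma_G L \<alpha> \<gamma>" and "0 < gamma_H L \<alpha> \<gamma>" and "gamma_H L \<alpha> \<gamma> < L_H L"
    and "((1 + \<kappa> * L) * ((1 + L * \<kappa>) / gamma_G L \<alpha> \<gamma> + \<kappa>) + \<kappa>) \<le> inverse (gamma_H L \<alpha> \<gamma>)"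
proof -
  define \<sigma> where "\<sigma> = gamma_G L \<alpha> \<gamma>"
  define h where "h = 1 / \<sigma>"
  define M where "M = L_H L"
  define mu where "mu = mu_bar L \<alpha> \<gamma>"
  have M: "M = 2 * L + 1" by (simp add: M_def L_H_def)
  have "(1 - \<alpha>) * 1 \<le> (1 + L) * L" using L \<alpha> by (intro mult_mono) auto
  then have \<kappa>1: "1 \<le> \<kappa>" using \<alpha> by (simp add: \<kappa> field_simps)
  have \<sigma>0: "0 < \<sigma>" using L \<alpha> \<gamma> by (simp add: \<sigma>_def gamma_G_def)
  then show "0 < gamma_G L \<alpha> \<gamma>" by (simp add: \<sigma>_def)
  have "\<gamma> * (1 - \<alpha>)\<^sup>2 \<le> 1 * 1" using \<alpha> \<gamma> by (intro mult_mono power_le_one) auto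
  also have "1 * 1 \<le> 2 * (1 + L)\<^sup>2 * L ^ 4"
  proof -
    have "1 \<le> (1 + L)\<^sup>2" "1 \<le> L ^ 4" using L by (auto intro!: one_le_power)
    then have "1 * 1 \<le> (1 + L)\<^sup>2 * L ^ 4" by (intro mult_mono) auto
    then show ?thesis by simp
  qed
  finally have "\<sigma> \<le> 1" using L by (simp add: \<sigma>_def gamma_G_def divide_le_eq)
  then have h1: "1 \<le> h" using \<sigma>0 by (simp add: h_def)
  have \<phi>: "1 / gamma_F L \<alpha> = \<kappa>\<^sup>2" by (simp add: gamma_F_def \<kappa> power_divide power_mult_distrib)
  have mu0: "0 \<le> mu"
  proof -
    have "0 \<le> gamma_F L \<alpha>" by (simp add: gamma_F_def)
    then show ?thesis using \<sigma>0 M L unfolding mu_def mu_bar_def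
      by (simp flip: \<sigma>_def M_def)
  qed
  have inv: "inverse (gamma_H L \<alpha> \<gamma>) = 2 * h + (1 + 4 * M * h + 4 * M\<^sup>2 * h\<^sup>2) * (M * (1 + mu * M) * \<kappa>\<^sup>2) + mu"
    unfolding gamma_H_def inverse_inverse_eq h_def \<phi>[symmetric] M_def[symmetric] \<sigma>_def[symmetric] mu_def[symmetric]
    by (simp add: power_divide)
  have "(1 + \<kappa> * L) * ((1 + L * \<kappa>) / \<sigma> + \<kappa>) + \<kappa> = (1 + \<kappa> * L) * ((1 + L * \<kappa>) * h + \<kappa>) + \<kappa>"
    by (simp add: h_def)
  also have "\<dots> \<le> (\<kappa> * (1 + L)) * ((\<kappa> * (1 + L)) * h + \<kappa> * h) + \<kappa> * (\<kappa> * h)"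
  proof (intro add_mono mult_mono)
    have kh: "\<kappa> * 1 \<le> \<kappa> * h" using h1 \<kappa>1 by (intro mult_left_mono) auto
    then show "\<kappa> \<le> \<kappa> * h" by (simp only: mult_1_right)
    show "1 + \<kappa> * L \<le> \<kappa> * (1 + L)" "1 + L * \<kappa> \<le> \<kappa> * (1 + L)" using \<kappa>1 by (simp_all add: algebra_simps)
    have "1 \<le> \<kappa> * h" using \<kappa>1 kh by linarith
    then have "\<kappa> * 1 \<le> \<kappa> * (\<kappa> * h)" using \<kappa>1 by (intro mult_left_mono) auto
    then show "\<kappa> \<le> \<kappa> * (\<kappa> * h)" by (simp only: mult_1_right)
  qed (use L \<kappa>1 h1 in \<open>auto intro!: mult_nonneg_nonneg add_nonneg_nonneg\<close>)
  also have "\<dots> = \<kappa>\<^sup>2 * h * (L\<^sup>2 + 3 * L + 3)" by (simp add: power2_eq_square algebra_simps)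
  also have "\<dots> \<le> \<kappa>\<^sup>2 * h * (4 * M ^ 2 * (M * h))"
  proof (intro mult_left_mono)
    have "0 \<le> 15 * L\<^sup>2 + 13 * L + 1" using L by simp
    then have "L\<^sup>2 + 3 * L + 3 \<le> 4 * M ^ 2 * 1" unfolding M by (simp add: power2_eq_square algebra_simps)
    also have "\<dots> \<le> 4 * M ^ 2 * (M * h)"
      using mult_mono[of 1 M 1 h] L h1 by (intro mult_left_mono) (auto simp: M)
    finally show "L\<^sup>2 + 3 * L + 3 \<le> 4 * M ^ 2 * (M * h)" .
  qed (use h1 in auto)
  also have "\<dots> = (4 * M ^ 2 * h\<^sup>2) * (M * 1 * \<kappa>\<^sup>2)" by (simp add: power2_eq_square)
  also have "\<dots> \<le> (1 + 4 * M * h + 4 * M\<^sup>2 * h\<^sup>2) * (M * (1 + mu * M) * \<kappa>\<^sup>2)"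
    using M L h1 mu0 by (intro mult_mono) auto
  also have "\<dots> \<le> inverse (gamma_H L \<alpha> \<gamma>)" unfolding inv using h1 mu0 by simp
  finally show C: "((1 + \<kappa> * L) * ((1 + L * \<kappa>) / gamma_G L \<alpha> \<gamma> + \<kappa>) + \<kappa>) \<le> inverse (gamma_H L \<alpha> \<gamma>)"
    by (simp add: \<sigma>_def)
  have "0 \<le> (1 + \<kappa> * L) * ((1 + L * \<kappa>) / gamma_G L \<alpha> \<gamma> + \<kappa>)"
    using \<sigma>0 \<kappa>1 L by (simp add: \<sigma>_def)
  then have i1: "1 \<le> inverse (gamma_H L \<alpha> \<gamma>)" using C \<kappa>1 by linarith
  then have "0 < gamma_H L \<alpha> \<gamma> \<and> gamma_H L \<alpha> \<gamma> \<le> 1" by (simp add: one_le_inverse_iff)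
  then show "0 < gamma_H L \<alpha> \<gamma>" by simp
  have "gamma_H L \<alpha> \<gamma> \<le> 1" using i1 by (simp add: one_le_inverse_iff)
  then show "gamma_H L \<alpha> \<gamma> < L_H L" using M L by (simp add: M_def)
qed

lemma matrix_vector_mult_lin: "C *v (a *\<^sub>R x + b *\<^sub>R y) = a *\<^sub>R (C *v x) + b *\<^sub>R (C *v y)"
  for C :: "real^'n^'m"
  by (simp add: linear_add[OF matrix_vector_mul_linear] linear_scale[OF matrix_vector_mul_linear])

text \<open>\<open>S\<close> stands for the square root of \<open>Q\<close> and is known only
  through its norm. The bound on \<open>K'\<close> leaves out k, since k may sit at stage 0, where
  Assumption 2 provides no such gain.\<close>

locale tree_lq = weighted_tree V p k par dep
  for V :: "'i set" and p k par dep +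
  fixes A :: "'i \<Rightarrow> real^'nx^'nx" and B :: "'i \<Rightarrow> real^'nu^'nx"
    and Q :: "'i \<Rightarrow> real^'nx^'nx" and R :: "'i \<Rightarrow> real^'nu^'nu"
    and K :: "'i \<Rightarrow> real^'nx^'nu" and K' :: "'i \<Rightarrow> real^'nx^'nx" and S :: "'i \<Rightarrow> real^'nx^'nx"
    and L \<alpha> \<gamma> :: real
  assumes L: "1 \<le> L" and \<alpha>: "0 < \<alpha>" "\<alpha> < 1" and \<gamma>: "0 < \<gamma>" "\<gamma> \<le> 1"
    and symQ: "i \<in> V \<Longrightarrow> transpose (Q i) = Q i" and symR: "i \<in> V \<Longrightarrow> transpose (R i) = R i"
    and bounds: "i \<in> V \<Longrightarrow> opnorm (A i) \<le> L" "i \<in> V \<Longrightarrow> opnorm (B i) \<le> L"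
      "i \<in> V \<Longrightarrow> opnorm (Q i) \<le> L" "i \<in> V \<Longrightarrow> opnorm (R i) \<le> L" "i \<in> V \<Longrightarrow> opnorm (K i) \<le> L"
      "i \<in> V \<Longrightarrow> i \<noteq> k \<Longrightarrow> opnorm (K' i) \<le> L"
    and S: "i \<in> V \<Longrightarrow> (norm (S i *v x))\<^sup>2 = x \<bullet> (Q i *v x)"
    and R: "i \<in> V \<Longrightarrow> \<gamma> * (norm u)\<^sup>2 \<le> u \<bullet> (R i *v u)"
    and stab: "i \<in> V \<Longrightarrow> s \<le> dep i \<Longrightarrow>
      opnorm (path_prod par (\<lambda>i. A i - B i ** K (par i)) s i) \<le> L * \<alpha> ^ s"
    and detect: "i \<in> V \<Longrightarrow> s \<le> dep i \<Longrightarrow>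
      opnorm (path_prod par (\<lambda>i. A i - K' i ** S (par i)) s i) \<le> L * \<alpha> ^ s"
begin

definition dyn :: "('i \<Rightarrow> real^'nx) \<Rightarrow> ('i \<Rightarrow> real^'nu) \<Rightarrow> 'i \<Rightarrow> real^'nx" where
  "dyn x u i = x i - (A i *v sh x i + B i *v sh u i)"

definition adj :: "('i \<Rightarrow> real^'m^'nx) \<Rightarrow> ('i \<Rightarrow> real^'nx) \<Rightarrow> 'i \<Rightarrow> real^'m" where
  "adj C y i = (\<Sum>j\<in>ch i. (p j / p i) *\<^sub>R (transpose (C j) *v y j))"

text \<open>Stationarity rows are divided by their conditional probability. The multiplier enters
  them through minus the adjoint of \<open>dyn\<close>, so symmetry forces the minus sign in the
  last row.\<close>

definition KKT :: "('i \<Rightarrow> (real^'nx) \<times> (real^'nu) \<times> (real^'nx)) \<Rightarrow> 'i \<Rightarrow> (real^'nx) \<times> (real^'nu) \<times> (real^'nx)" where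
  "KKT z i =
    (Q i *v fst (z i) - (snd (snd (z i)) - adj A (\<lambda>i. snd (snd (z i))) i),
     R i *v fst (snd (z i)) + adj B (\<lambda>i. snd (snd (z i))) i,
     - dyn (\<lambda>i. fst (z i)) (\<lambda>i. fst (snd (z i))) i)"

lemma ip_adj: "ip f (adj C y) = ip (\<lambda>i. C i *v sh f i) y"
  by (simp add: ip_sh_adjoint adj_def[abs_def])

lemma norm_mv_le: "opnorm C \<le> L \<Longrightarrow> norm (C *v x) \<le> L * norm x"
  using norm_matrix_vector_le_opnorm[of C x] mult_right_mono[of "opnorm C" L "norm x"] by simp

lemma nrm_mv_le:
  assumes "\<And>i. i \<in> V \<Longrightarrow> opnorm (C i) \<le> L"
  shows "nrm (\<lambda>i. C i *v f i) \<le> L * nrm f"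
proof -
  have "nrm (\<lambda>i. C i *v f i) \<le> \<bar>L\<bar> * nrm f"
    by (rule nrm_le_scale) (simp add: norm_mv_le assms)
  then show ?thesis using L by simp
qed

lemma nrm_mv_sh_le:
  assumes "\<And>i. i \<in> V \<Longrightarrow> i \<noteq> k \<Longrightarrow> opnorm (C i) \<le> L"
  shows "nrm (\<lambda>i. C i *v sh f i) \<le> L * nrm f"
proof -
  have "nrm (\<lambda>i. C i *v sh f i) \<le> \<bar>L\<bar> * nrm (sh f)"
  proof (rule nrm_le_scale)
    show "norm (C i *v sh f i) \<le> L * norm (sh f i)" if "i \<in> V" for i
      using assms[OF that] norm_mv_le by (cases "i = k") (auto simp: sh_def)
  qed
  also have "\<dots> \<le> L * nrm f" using L nrm_sh[of f] by (simp add: mult_left_mono)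
  finally show ?thesis .
qed

text \<open>L / (1 - \<alpha>) sums the closed-loop decay, and 1 + L accounts for appending the
  feedback u to x.\<close>

lemma dyn_right_inverse:
  "\<exists>x u. (\<forall>i\<in>V. dyn x u i = b i) \<and> nrm (\<lambda>i. (x i, u i)) \<le> (1 + L) * L / (1 - \<alpha>) * nrm b"
proof -
  define x where "x = path_sum (\<lambda>i. A i - B i ** K (par i)) b"
  define u where "u = (\<lambda>i. - (K i *v x i))"
  have rec: "x i = (A i - B i ** K (par i)) *v sh x i + b i" if "i \<in> V" for i
    unfolding x_def by (rule path_sum_rec[OF that])
  have "nrm x \<le> L / (1 - \<alpha>) * nrm b"
    by (rule nrm_recursion[OF _ _ _ rec stab]) (use \<alpha> L in auto)
  then have "(1 + L) * nrm x \<le> (1 + L) * (L / (1 - \<alpha>) * nrm b)" using L by (intro mult_left_mono) auto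
  moreover have "nrm u \<le> L * nrm x" unfolding u_def nrm_minus by (rule nrm_mv_le) (rule bounds)
  moreover have "nrm (\<lambda>i. (x i, u i)) \<le> nrm x + nrm u" by (rule nrm_Pair_le)
  ultimately have "nrm (\<lambda>i. (x i, u i)) \<le> (1 + L) * L / (1 - \<alpha>) * nrm b" by (simp add: algebra_simps)
  moreover have "dyn x u i = b i" if "i \<in> V" for i
    using rec[OF that]
    by (cases "i = k") (simp_all add: dyn_def sh_def u_def matrix_vector_mult_diff_rdistrib
        linear_neg[OF matrix_vector_mul_linear] matrix_vector_mul_assoc algebra_simps)
  ultimately show ?thesis by blast
qed

text \<open>Output injection: adding and subtracting \<open>K'\<close> applied to the parent's S x
  turns the dynamics into a stable recursion driven only by S x and u, both of which the cost
  controls. The 2 in \<open>gamma_G\<close> comes from (s + t)^2 \<le> 2 (s^2 + t^2).\<close>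

lemma hessian_coercive:
  assumes "\<And>i. i \<in> V \<Longrightarrow> dyn x u i = 0"
  shows "gamma_G L \<alpha> \<gamma> * (nrm (\<lambda>i. (x i, u i)))\<^sup>2 \<le> ip x (\<lambda>i. Q i *v x i) + ip u (\<lambda>i. R i *v u i)"
proof -
  define s where "s = nrm (\<lambda>i. S i *v x i)"
  define t where "t = nrm u"
  define m where "m = (1 + L) * L\<^sup>2 / (1 - \<alpha>)"
  define v where "v = (\<lambda>i. K' i *v sh (\<lambda>i. S i *v x i) i + B i *v sh u i)"
  have st: "0 \<le> s" "0 \<le> t" by (simp_all add: s_def t_def)
  have rec: "x i = (A i - K' i ** S (par i)) *v sh x i + v i" if "i \<in> V" for i
    using assms[OF that]
    by (cases "i = k") (simp_all add: dyn_def sh_def v_def matrix_vector_mult_diff_rdistrib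
        matrix_vector_mul_assoc algebra_simps)
  have "nrm v \<le> L * s + L * t"
    unfolding v_def s_def t_def
    by (intro order_trans[OF nrm_triangle] add_mono nrm_mv_sh_le bounds)
  moreover have "nrm x \<le> L / (1 - \<alpha>) * nrm v"
    by (rule nrm_recursion[OF _ _ _ rec detect]) (use \<alpha> L in auto)
  ultimately have "nrm x \<le> L / (1 - \<alpha>) * (L * s + L * t)"
    using L \<alpha> mult_left_mono[of "nrm v" "L * s + L * t" "L / (1 - \<alpha>)"] by simp
  also have "L / (1 - \<alpha>) * (L * s + L * t) = L\<^sup>2 / (1 - \<alpha>) * (s + t)"
    by (simp add: power2_eq_square distrib_left mult.assoc)
  finally have "nrm x + t \<le> L\<^sup>2 / (1 - \<alpha>) * (s + t) + 1 * (s + t)"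
    using st by (intro add_mono) auto
  also have "\<dots> = (L\<^sup>2 / (1 - \<alpha>) + 1) * (s + t)" by (simp add: algebra_simps)
  \<comment> \<open>The extra 1, which stems from counting u itself, is absorbed by
    \<open>L ^ 3 / (1 - \<alpha>)\<close>.\<close>
  also have "\<dots> \<le> m * (s + t)"
  proof (rule mult_right_mono)
    have "1 - \<alpha> \<le> 1 * 1" using \<alpha> by simp
    also have "1 * 1 \<le> L * L\<^sup>2" using L by (intro mult_mono one_le_power) auto
    finally have "1 \<le> L * L\<^sup>2 / (1 - \<alpha>)" using \<alpha> by (simp add: le_divide_eq)
    then show "L\<^sup>2 / (1 - \<alpha>) + 1 \<le> m" by (simp add: m_def distrib_right add_divide_distrib)
  qed (use st in simp)
  finally have "nrm (\<lambda>i. (x i, u i)) \<le> m * (s + t)"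
    using nrm_Pair_le[of x u] by (simp add: t_def)
  then have "(nrm (\<lambda>i. (x i, u i)))\<^sup>2 \<le> (m * (s + t))\<^sup>2" by (rule power_mono) simp
  also have "\<dots> \<le> m\<^sup>2 * (2 * (s\<^sup>2 + t\<^sup>2))"
    unfolding power_mult_distrib using sum_squares_bound[of s t]
    by (intro mult_left_mono) (auto simp: power2_sum)
  finally have n: "(nrm (\<lambda>i. (x i, u i)))\<^sup>2 \<le> 2 * m\<^sup>2 * (s\<^sup>2 + t\<^sup>2)" by (simp only: mult_ac)
  have m: "m > 0" using L \<alpha> by (simp add: m_def)
  have G: "gamma_G L \<alpha> \<gamma> = \<gamma> / (2 * m\<^sup>2)"
    by (simp add: gamma_G_def m_def power_divide power_mult_distrib flip: power_mult)
  have "gamma_G L \<alpha> \<gamma> * (nrm (\<lambda>i. (x i, u i)))\<^sup>2 \<le> \<gamma> / (2 * m\<^sup>2) * (2 * m\<^sup>2 * (s\<^sup>2 + t\<^sup>2))"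
    unfolding G using n \<gamma> m by (intro mult_left_mono) auto
  also have "\<dots> = \<gamma> * s\<^sup>2 + \<gamma> * t\<^sup>2" using m by (simp add: field_simps)
  also have "\<dots> \<le> 1 * s\<^sup>2 + \<gamma> * t\<^sup>2" using \<gamma> by (intro add_right_mono mult_right_mono) auto
  also have "\<dots> \<le> ip x (\<lambda>i. Q i *v x i) + ip u (\<lambda>i. R i *v u i)"
  proof (rule add_mono)
    show "1 * s\<^sup>2 \<le> ip x (\<lambda>i. Q i *v x i)"
      unfolding s_def nrm_power2_sum ip_def by (simp add: S)
    show "\<gamma> * t\<^sup>2 \<le> ip u (\<lambda>i. R i *v u i)"
      unfolding t_def nrm_power2_sum ip_def sum_distrib_left
    proof (rule sum_mono)
      show "\<gamma> * (p i * (norm (u i))\<^sup>2) \<le> p i * (u i \<bullet> (R i *v u i))" if "i \<in> V" for i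
        using mult_left_mono[OF R[OF that, of "u i"] p_ge[OF that]] by (simp add: mult.left_commute)
    qed
  qed
  finally show ?thesis .
qed

lemma ip_symmetric_mv:
  fixes C :: "'i \<Rightarrow> real^'n^'n"
  assumes "\<And>i. i \<in> V \<Longrightarrow> transpose (C i) = C i"
  shows "ip (\<lambda>i. C i *v f i) g = ip f (\<lambda>i. C i *v g i)"
  using assms by (simp add: ip_def inner_transpose_matrix)

text \<open>In this form the coupling terms are visibly invariant under exchanging the two triples,
  which leaves only Q and R for the symmetry proof; the form bound starts here as well.\<close>

lemma ip_KKT:
  "ip (KKT (\<lambda>i. (x i, u i, y i))) (\<lambda>i. (x' i, u' i, y' i)) =
    ip (\<lambda>i. Q i *v x i) x' + ip (\<lambda>i. R i *v u i) u' - (ip x' y + ip x y')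
     + (ip (\<lambda>i. A i *v sh x' i) y + ip (\<lambda>i. A i *v sh x i) y')
     + (ip (\<lambda>i. B i *v sh u' i) y + ip (\<lambda>i. B i *v sh u i) y')"
  using ip_adj[of x' A y] ip_adj[of u' B y] ip_commute[of y x'] ip_commute[of "adj A y" x']
    ip_commute[of "adj B y" u']
  by (simp add: KKT_def[abs_def] ip_Pair dyn_def[abs_def] ip_simps)

lemma KKT_symmetric: "ip (KKT z) z' = ip z (KKT z')"
proof -
  have "ip (KKT (\<lambda>i. (x i, u i, y i))) (\<lambda>i. (x' i, u' i, y' i)) =
    ip (KKT (\<lambda>i. (x' i, u' i, y' i))) (\<lambda>i. (x i, u i, y i))" for x u y x' u' y'
  proof -
    have "ip (\<lambda>i. Q i *v x i) x' = ip x (\<lambda>i. Q i *v x' i)"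
      by (rule ip_symmetric_mv) (rule symQ)
    moreover have "ip (\<lambda>i. R i *v u i) u' = ip u (\<lambda>i. R i *v u' i)"
      by (rule ip_symmetric_mv) (rule symR)
    ultimately show ?thesis
      unfolding ip_KKT by (simp add: ip_commute[of x] ip_commute[of u])
  qed
  from this[of "\<lambda>i. fst (z i)" "\<lambda>i. fst (snd (z i))" "\<lambda>i. snd (snd (z i))"
      "\<lambda>i. fst (z' i)" "\<lambda>i. fst (snd (z' i))" "\<lambda>i. snd (snd (z' i))"]
  show ?thesis by (simp add: ip_commute)
qed

lemma KKT_form_le: "\<bar>ip (KKT z) z\<bar> \<le> L_H L * (nrm z)\<^sup>2"
proof -
  define x where "x = (\<lambda>i. fst (z i))"
  define u where "u = (\<lambda>i. fst (snd (z i)))"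
  define y where "y = (\<lambda>i. snd (snd (z i)))"
  have z: "z = (\<lambda>i. (x i, u i, y i))" by (simp add: x_def u_def y_def)
  define a b c where "a = nrm x" and "b = nrm u" and "c = nrm y"
  have abc: "0 \<le> a" "0 \<le> b" "0 \<le> c" by (simp_all add: a_def b_def c_def)
  have "\<bar>ip (\<lambda>i. Q i *v x i) x\<bar> \<le> (L * a) * a" "\<bar>ip (\<lambda>i. R i *v u i) u\<bar> \<le> (L * b) * b"
    "\<bar>ip (\<lambda>i. A i *v sh x i) y\<bar> \<le> (L * a) * c" "\<bar>ip (\<lambda>i. B i *v sh u i) y\<bar> \<le> (L * b) * c"
    "\<bar>ip x y\<bar> \<le> a * c"
    unfolding a_def b_def c_def
    by (intro order_trans[OF abs_ip_le] mult_right_mono nrm_mv_le nrm_mv_sh_le bounds order_refl nrm_ge_0; assumption)+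
  then have "\<bar>ip (KKT z) z\<bar> \<le> L * a\<^sup>2 + L * b\<^sup>2 + 2 * (a * c) + 2 * (L * (a * c)) + 2 * (L * (b * c))"
    unfolding z ip_KKT by (simp add: power2_eq_square mult.assoc)
  also have "\<dots> \<le> (2 * L + 1) * (a\<^sup>2 + (b\<^sup>2 + c\<^sup>2))"
  proof -
    \<comment> \<open>This sum of squares is exactly the difference of the two sides, and the reason
      why 2 L + 1 suffices.\<close>
    have "0 \<le> (L + 1) * (a - c)\<^sup>2 + L * (b - c)\<^sup>2 + b\<^sup>2" using L by simp
    then show ?thesis by (simp add: power2_eq_square algebra_simps)
  qed
  also have "\<dots> = L_H L * (nrm z)\<^sup>2"
    by (simp add: z nrm_Pair_power2 L_H_def a_def b_def c_def)
  finally show ?thesis .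
qed

lemma KKT_lower: "gamma_H L \<alpha> \<gamma> * nrm z \<le> nrm (KKT z)"
proof -
  define w where "w = (\<lambda>i. (fst (z i), fst (snd (z i))))"
  define y where "y = (\<lambda>i. snd (snd (z i)))"
  define F where "F = (\<lambda>w. dyn (\<lambda>i. fst (w i)) (\<lambda>i. snd (w i)))"
  define G where "G = (\<lambda>w i. (Q i *v fst (w i), R i *v snd (w i)))"
  define Fa where "Fa = (\<lambda>y i. (y i - adj A y i, - adj B y i))"
  define \<kappa> where "\<kappa> = (1 + L) * L / (1 - \<alpha>)"
  note gam = gamma_H_bounds[OF L \<alpha> \<gamma> \<kappa>_def]
  have "nrm w + nrm y \<le> ((1 + \<kappa> * L) * ((1 + L * \<kappa>) / gamma_G L \<alpha> \<gamma> + \<kappa>) + \<kappa>) * nrm (KKT z)"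
  proof (rule saddle_point_lower_bound[where F=F and G=G and Fa=Fa])
    show "F (\<lambda>i. w i - w' i) i = F w i - F w' i" for w w' i
      by (simp add: F_def dyn_def sh_def matrix_vector_mult_diff_distrib algebra_simps)
    show "G (\<lambda>i. w i - w' i) i = G w i - G w' i" for w w' i
      by (simp add: G_def matrix_vector_mult_diff_distrib)
    show "ip (F w) y = ip w (Fa y)" for w y
    proof -
      have "ip w (Fa y) = ip (\<lambda>i. (fst (w i), snd (w i))) (Fa y)" by simp
      then show ?thesis
        unfolding F_def Fa_def dyn_def[abs_def] ip_Pair by (simp add: ip_simps ip_adj)
    qed
    show "nrm (G w) \<le> L * nrm w" for w
    proof -
      have "nrm (G w) \<le> \<bar>L\<bar> * nrm w"
      proof (rule nrm_le_scale)
        fix i assume i: "i \<in> V"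
        have "(norm (G w i))\<^sup>2 \<le> (L * norm (fst (w i)))\<^sup>2 + (L * norm (snd (w i)))\<^sup>2"
          unfolding G_def norm_Pair fst_conv snd_conv real_sqrt_pow2[OF add_nonneg_nonneg[OF zero_le_power2 zero_le_power2]]
          by (intro add_mono power_mono norm_mv_le bounds i norm_ge_zero)
        also have "\<dots> = (L * norm (w i))\<^sup>2"
          by (cases "w i") (simp add: norm_Pair power_mult_distrib distrib_left)
        finally show "norm (G w i) \<le> L * norm (w i)" by (rule power2_le_imp_le) (use L in simp)
      qed
      then show ?thesis using L by simp
    qed
    show "gamma_G L \<alpha> \<gamma> * (nrm w)\<^sup>2 \<le> ip w (G w)" if "\<And>i. i \<in> V \<Longrightarrow> F w i = 0" for w
      using hessian_coercive[of "\<lambda>i. fst (w i)" "\<lambda>i. snd (w i)"] that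
        ip_Pair[of "\<lambda>i. fst (w i)" "\<lambda>i. snd (w i)" "\<lambda>i. Q i *v fst (w i)" "\<lambda>i. R i *v snd (w i)"]
      by (simp add: F_def G_def)
    show "\<exists>w. (\<forall>i\<in>V. F w i = b i) \<and> nrm w \<le> \<kappa> * nrm b" for b
    proof -
      obtain x u where "\<forall>i\<in>V. dyn x u i = b i" "nrm (\<lambda>i. (x i, u i)) \<le> \<kappa> * nrm b"
        using dyn_right_inverse[of b] unfolding \<kappa>_def by blast
      then show ?thesis by (intro exI[of _ "\<lambda>i. (x i, u i)"]) (simp add: F_def)
    qed
    show "nrm (\<lambda>i. G w i - Fa y i) \<le> nrm (KKT z)"
    proof (rule nrm_mono)
      fix i
      have "KKT z i = (fst (G w i - Fa y i), snd (G w i - Fa y i), - F w i)"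
        by (simp add: KKT_def G_def Fa_def F_def w_def y_def)
      then show "norm (G w i - Fa y i) \<le> norm (KKT z i)"
        by (cases "G w i - Fa y i") (simp add: norm_Pair)
    qed
    show "nrm (F w) \<le> nrm (KKT z)"
      by (rule nrm_mono) (simp add: KKT_def F_def w_def norm_Pair real_le_rsqrt)
  qed (use gam L \<alpha> in \<open>auto simp: \<kappa>_def\<close>)
  also have "\<dots> \<le> inverse (gamma_H L \<alpha> \<gamma>) * nrm (KKT z)" using gam by (intro mult_right_mono) auto
  finally have "gamma_H L \<alpha> \<gamma> * (nrm w + nrm y) \<le> nrm (KKT z)"
    using gam by (simp add: field_simps)
  moreover have "nrm z \<le> nrm w + nrm y"
  proof (rule order_trans[OF nrm_mono nrm_Pair_le])
    show "norm (z i) \<le> norm (w i, y i)" for i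
      by (cases "z i") (simp add: w_def y_def norm_Pair)
  qed
  ultimately show ?thesis using gam by (meson less_imp_le mult_left_mono order_trans)
qed

lemma adj_lin: "adj C (\<lambda>i. a *\<^sub>R y i + b *\<^sub>R y' i) i = a *\<^sub>R adj C y i + b *\<^sub>R adj C y' i"
  by (simp add: adj_def matrix_vector_mult_lin scaleR_sum_right sum.distrib scaleR_add_right mult.commute
    del: transpose_matrix_vector)

lemma KKT_lin: "KKT (\<lambda>i. a *\<^sub>R f i + b *\<^sub>R h i) i = a *\<^sub>R KKT f i + b *\<^sub>R KKT h i"
  by (simp add: KKT_def dyn_def sh_lin adj_lin matrix_vector_mult_lin scaleR_diff_right scaleR_add_right)

text \<open>A row reads only the node, its children and its parent; this locality yields
  \<open>band\<close>.\<close>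

lemma KKT_eq_0:
  assumes "f i = 0" "\<And>j. j \<in> ch i \<Longrightarrow> f j = 0" "i \<noteq> k \<Longrightarrow> f (par i) = 0"
  shows "KKT f i = 0"
  using assms by (simp add: KKT_def dyn_def adj_def sh_def zero_prod_def)

sublocale banded_symmetric_operator V p KKT dep "L_H L" "gamma_H L \<alpha> \<gamma>"
proof
  show "0 < gamma_H L \<alpha> \<gamma>" "gamma_H L \<alpha> \<gamma> < L_H L"
    using gamma_H_bounds[OF L \<alpha> \<gamma> refl] by auto
  show "\<bar>int (dep i) - m\<bar> \<le> w + 1"
    if supp: "\<And>i. i \<in> V \<Longrightarrow> f i \<noteq> 0 \<Longrightarrow> \<bar>int (dep i) - m\<bar> \<le> w" and i: "i \<in> V" "KKT f i \<noteq> 0" for f m w i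
  proof -
    consider "f i \<noteq> 0" | j where "j \<in> ch i" "f j \<noteq> 0" | "i \<noteq> k" "f (par i) \<noteq> 0"
      using KKT_eq_0[of f i] i(2) by blast
    then show ?thesis
    proof cases
      case 1
      then show ?thesis using supp[OF i(1)] by simp
    next
      case 2
      then show ?thesis using supp[of j] dep_par[of j] by (auto simp: ch_def)
    next
      case 3
      then show ?thesis using supp[of "par i"] par_in dep_par[of i] i(1) by auto
    qed
  qed
qed (rule KKT_lin KKT_symmetric KKT_form_le KKT_lower)+

end

subsection \<open>Solution blocks\<close>

context banded_symmetric_operator
begin

text \<open>The value 0 outside \<open>V\<close> makes \<open>sol\<close> linear at every index,
  since the theorem asks for linear blocks at all i, j. On \<open>V\<close> any two solutions agree,
  so the choice does not matter there.\<close>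

definition sol :: "('i \<Rightarrow> 'v) \<Rightarrow> 'i \<Rightarrow> 'v" where
  "sol v i = (if i \<in> V then (SOME z. \<forall>i\<in>V. H z i = v i) i else 0)"

text \<open>The Green's function of \<open>H\<close>: the response at i to a source at j.\<close>

definition block :: "'i \<Rightarrow> 'i \<Rightarrow> 'v \<Rightarrow> 'v" where
  "block i j x = sol (\<lambda>l. if l = j then x else 0) i"

lemma sol_unique:
  assumes "\<And>i. i \<in> V \<Longrightarrow> H z i = v i" "i \<in> V"
  shows "z i = sol v i"
proof -
  have "\<forall>i\<in>V. H (SOME z. \<forall>i\<in>V. H z i = v i) i = v i"
    using solution_exists by (rule someI_ex)
  then show ?thesis
    using solution_unique[of z "SOME z. \<forall>i\<in>V. H z i = v i" i] assms by (simp add: sol_def)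
qed

text \<open>\<open>sol\<close> cuts the chosen solution off outside \<open>V\<close>. By
  \<open>nrm_H\<close>, values there cannot influence \<open>H\<close> on \<open>V\<close>.\<close>

lemma H_sol: "i \<in> V \<Longrightarrow> H (sol v) i = v i"
proof -
  assume i: "i \<in> V"
  obtain z where z: "\<And>i. i \<in> V \<Longrightarrow> H z i = v i" using solution_exists by blast
  have "nrm (\<lambda>i. sol v i - z i) = 0" by (simp add: nrm_eq_0_iff sol_unique[OF z])
  then have "nrm (\<lambda>i. H (sol v) i - H z i) \<le> 0"
    using nrm_H[of "\<lambda>i. sol v i - z i"] by (simp add: H_diff)
  then have "nrm (\<lambda>i. H (sol v) i - H z i) = 0" using nrm_ge_0 by (rule antisym)
  then show ?thesis using z i by (simp add: nrm_eq_0_iff)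
qed

lemma sol_lin: "sol (\<lambda>i. a *\<^sub>R f i + b *\<^sub>R h i) i = a *\<^sub>R sol f i + b *\<^sub>R sol h i"
proof (cases "i \<in> V")
  case True
  show ?thesis by (rule sol_unique[OF _ True, symmetric]) (simp add: lin H_sol)
qed (simp add: sol_def)

lemma sol_sum: "finite C \<Longrightarrow> sol (\<lambda>l. \<Sum>j\<in>C. f j l) i = (\<Sum>j\<in>C. sol (f j) i)"
proof (induction C rule: finite_induct)
  case empty
  show ?case using sol_lin[of 0 "\<lambda>_. 0" 0 "\<lambda>_. 0"] by simp
next
  case (insert x F)
  then show ?case using sol_lin[of 1 "f x" 1 "\<lambda>l. \<Sum>j\<in>F. f j l"] by simp
qed

lemma linear_block: "linear (block i j)"
proof -
  have "block i j (a *\<^sub>R x + b *\<^sub>R y) = a *\<^sub>R block i j x + b *\<^sub>R block i j y" for a b x y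
  proof -
    have "(\<lambda>l. if l = j then a *\<^sub>R x + b *\<^sub>R y else 0)
      = (\<lambda>l. a *\<^sub>R (if l = j then x else 0) + b *\<^sub>R (if l = j then y else 0))"
      by auto
    then show ?thesis unfolding block_def by (simp only: sol_lin)
  qed
  from this[of 1 _ 1] this[of _ _ 0] show ?thesis by (intro linearI) auto
qed

lemma sum_block:
  assumes "finite C"
  shows "(\<Sum>j\<in>C. block i j (v j)) = sol (\<lambda>l. if l \<in> C then v l else 0) i"
  unfolding block_def sol_sum[OF assms, symmetric] using assms by (simp add: sum.delta')

lemma sum_block_V: "i \<in> V \<Longrightarrow> (\<Sum>j\<in>V. block i j (v j)) = sol v i"
  unfolding sum_block[OF finV] by (rule sol_unique) (simp_all add: H_sol)

text \<open>The maps \<tau> and \<pi> let one estimate serve both matrices: \<tau> is the sign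
  change of d, while \<pi> is the identity for \<Omega> and drops the multiplier for \<Psi>.\<close>

lemma pinorm_block_le:
  fixes \<tau> :: "'u::real_normed_vector \<Rightarrow> 'v" and \<pi> :: "'v \<Rightarrow> 'w::real_normed_vector"
  assumes "linear \<pi>" and \<pi>: "\<And>x. norm (\<pi> x) \<le> norm x" and \<tau>: "\<And>x. norm (\<tau> x) \<le> norm x"
  shows "pinorm p {i\<in>V. dep i = t} {i\<in>V. dep i = m} (\<lambda>i j v. \<pi> (block i j (\<tau> v)))
    \<le> M / (g\<^sup>2 * sqrt theta) * sqrt theta ^ (if t \<le> m then m - t else t - m)"
  unfolding pinorm_def
proof (rule cSUP_least)
  show "{v :: 'i \<Rightarrow> 'u. (\<Sum>j | j \<in> V \<and> dep j = m. p j * (norm (v j))\<^sup>2) \<le> 1} \<noteq> {}"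
    by (auto intro!: exI[of _ "\<lambda>_. 0"])
  fix v :: "'i \<Rightarrow> 'u"
  let ?C = "{j\<in>V. dep j = m}" and ?c = "M / (g\<^sup>2 * sqrt theta) * sqrt theta ^ (if t \<le> m then m - t else t - m)"
  assume "v \<in> {v. (\<Sum>j\<in>?C. p j * (norm (v j))\<^sup>2) \<le> 1}"
  then have v: "(\<Sum>j\<in>?C. p j * (norm (v j))\<^sup>2) \<le> 1" by simp
  define f where "f = (\<lambda>l. if l \<in> ?C then \<tau> (v l) else 0)"
  have "(nrm f)\<^sup>2 = (\<Sum>j\<in>?C. p j * (norm (\<tau> (v j)))\<^sup>2)"
    unfolding nrm_power2_sum using finV by (intro sum.mono_neutral_cong_right) (auto simp: f_def)
  also have "\<dots> \<le> (\<Sum>j\<in>?C. p j * (norm (v j))\<^sup>2)"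
    using \<tau> by (intro sum_mono mult_left_mono power_mono) (auto simp: p_ge)
  finally have f1: "nrm f \<le> 1" using v by (simp add: power2_le_imp_le)
  have eq: "(\<Sum>j\<in>?C. \<pi> (block i j (\<tau> (v j)))) = \<pi> (sol f i)" for i
    using finV sum_block[of ?C i "\<lambda>l. \<tau> (v l)"] by (simp add: f_def linear_sum[OF assms(1), symmetric])
  have "sqrt (\<Sum>i\<in>{i\<in>V. dep i = t}. p i * (norm (\<Sum>j\<in>?C. \<pi> (block i j (\<tau> (v j)))))\<^sup>2)
    \<le> sqrt (\<Sum>i\<in>{i\<in>V. dep i = t}. p i * (norm (sol f i))\<^sup>2)"
    unfolding eq using \<pi> by (intro real_sqrt_le_mono sum_mono mult_left_mono power_mono) (auto simp: p_ge)
  also have "\<dots> \<le> ?c * nrm f"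
    by (rule solution_decay) (auto simp: H_sol f_def split: if_splits)
  also have "\<dots> \<le> ?c" using f1 theta g by (intro mult_left_le) auto
  finally show "sqrt (\<Sum>i\<in>{i\<in>V. dep i = t}. p i * (norm (\<Sum>j\<in>?C. \<pi> (block i j (\<tau> (v j)))))\<^sup>2) \<le> ?c" .
qed

end

subsection \<open>Windows of the scenario tree\<close>

locale scenario_window =
  fixes P :: "'a list pmf" and T :: nat and x0 :: 'a and k :: "'a list" and W :: enat
  assumes len: "\<forall>s\<in>set_pmf P. length s = Suc T"
    and fin: "finite (set_pmf P)"
    and k: "k \<in> tree_nodes P T x0"
begin

abbreviation "V \<equiv> win_nodes P T x0 k W"

lemma node_iff: "i \<in> V \<longleftrightarrow> (\<exists>s t. s \<in> set_pmf P \<and> hd s = x0 \<and> i = take (Suc t) s \<and> take (length k) i = k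
    \<and> t \<in> win_stages T k W)"
proof -
  have "stage (take (Suc t) s) = t" if "s \<in> set_pmf P" "t \<le> T" for s t
    using that len by (simp add: stage_def)
  then show ?thesis
    by (fastforce simp: win_nodes_def desc_def tree_nodes_def win_stages_def)
qed

text \<open>Each node comes with a full scenario through it, because the assumptions are stated
  scenario by scenario.\<close>

lemma nodeE:
  assumes "i \<in> V"
  obtains s t where "s \<in> set_pmf P" "hd s = x0" "i = take (Suc t) s" "take (length k) i = k"
    "t \<in> win_stages T k W" "stage i = t" "length i = Suc t" "last i = s ! t" "butlast i = take t s"
    "t \<le> T" "stage k \<le> t"
proof -
  obtain s t where st: "s \<in> set_pmf P" "hd s = x0" "i = take (Suc t) s" "take (length k) i = k" "t \<in> win_stages T k W"
    using assms unfolding node_iff by blast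
  have "t \<le> T" "stage k \<le> t" using st by (auto simp: win_stages_def)
  moreover from this have "take (Suc t) s = take t s @ [s ! t]"
    using st(1) len by (simp add: take_Suc_conv_app_nth)
  ultimately show ?thesis using st len
    by (intro that[of s t]) (auto simp: stage_def)
qed

lemma length_k: "length k = Suc (stage k)"
  using k len by (auto simp: tree_nodes_def stage_def)

lemma root_in: "k \<in> V"
proof -
  obtain s t where "k = take (Suc t) s" "s \<in> set_pmf P" "hd s = x0" "t \<le> T"
    using k by (auto simp: tree_nodes_def)
  moreover from this have "t \<in> win_stages T k W" using len by (simp add: stage_def win_stages_def)
  moreover have "take (length k) k = k" by simp
  ultimately show ?thesis unfolding node_iff by blast
qed

lemma stage_gt: "i \<in> V \<Longrightarrow> i \<noteq> k \<Longrightarrow> stage k < stage i"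
  by (erule nodeE) (use length_k in \<open>auto simp: le_less\<close>)

lemma butlast_in: assumes "i \<in> V" "i \<noteq> k" shows "butlast i \<in> V"
proof -
  from assms(1) show ?thesis
  proof (cases rule: nodeE)
    case (1 s t)
    then have "stage k < t" using stage_gt[OF assms] by simp
    then obtain t' where t': "t = Suc t'" "stage k \<le> t'" by (cases t) auto
    have "t' \<in> win_stages T k W"
      using 1(5) t' by (auto simp: win_stages_def elim!: order_trans[rotated])
    moreover have "take (length k) (take t s) = k" using 1 t' length_k by (simp add: min_def)
    ultimately show ?thesis 
      unfolding node_iff using 1 t' by (intro exI[of _ s] exI[of _ t']) simp
  qed
qed

lemma desc_eq: "t \<in> win_stages T k W \<Longrightarrow> desc P T x0 k t = {i\<in>V. stage i - stage k = t - stage k}"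
  by (auto simp: win_nodes_def desc_def win_stages_def)

lemma finite_V: "finite V"
proof -
  have "V \<subseteq> (\<lambda>(s, t). take (Suc t) s) ` (set_pmf P \<times> {..T})"
    by (auto elim!: nodeE)
  then show ?thesis using fin by (auto intro: finite_subset)
qed

lemma hd_prob_pos: "s \<in> set_pmf P \<Longrightarrow> Q s \<Longrightarrow> 0 < measure_pmf.prob P {s. Q s}"
  by (rule measure_pmf_posI) auto

lemma node_prob_pos: "i \<in> V \<Longrightarrow> 0 < node_prob P x0 i"
  by (erule nodeE) (auto simp: node_prob_def intro!: divide_pos_pos hd_prob_pos)

text \<open>Children of i have equal length, so the events of passing through them are disjoint, and
  each lies in the event of passing through i.\<close>

lemma children_mass:
  assumes "i \<in> V"
  shows "(\<Sum>j\<in>{j\<in>V. j \<noteq> k \<and> butlast j = i}. node_prob P x0 j) \<le> node_prob P x0 i"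
proof -
  define C where "C = {j\<in>V. j \<noteq> k \<and> butlast j = i}"
  define E where "E j = {s. take (length j) s = j \<and> hd s = x0}" for j
  have C: "length j = Suc (length i)" "take (length i) j = i" if "j \<in> C" for j
  proof -
    have j: "j \<in> V" "butlast j = i" using that by (auto simp: C_def)
    from j(1) show "length j = Suc (length i)" using j(2) by (elim nodeE) auto
    then show "take (length i) j = i" using j(2) by (simp add: butlast_conv_take)
  qed
  have "(\<Sum>j\<in>C. measure_pmf.prob P (E j)) = measure_pmf.prob P (\<Union>j\<in>C. E j)"
  proof (rule measure_pmf.finite_measure_finite_Union[symmetric])
    show "finite C" using finite_V by (simp add: C_def)
    show "disjoint_family_on E C"
      using C(1) by (fastforce simp: disjoint_family_on_def E_def)
  qed simp
  also have "\<dots> \<le> measure_pmf.prob P (E i)"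
  proof (rule measure_pmf.finite_measure_mono)
    show "(\<Union>j\<in>C. E j) \<subseteq> E i"
    proof
      fix s assume "s \<in> (\<Union>j\<in>C. E j)"
      then obtain j where j: "j \<in> C" "take (length j) s = j" "hd s = x0" by (auto simp: E_def)
      have "take (length i) (take (length j) s) = take (length i) s" using C(1)[OF j(1)] by (simp add: min_def)
      then show "s \<in> E i" using j C(2)[OF j(1)] by (simp add: E_def)
    qed
  qed simp
  finally show ?thesis
    unfolding C_def[symmetric] node_prob_def E_def sum_divide_distrib[symmetric]
    by (rule divide_right_mono) simp
qed

sublocale weighted_tree V "node_prob P x0" k butlast "\<lambda>i. stage i - stage k"
proof
  show "stage i - stage k = Suc (stage (butlast i) - stage k)" if "i \<in> V" "i \<noteq> k" for i
    using stage_gt[OF that] by (simp add: stage_def)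
qed (simp_all add: finite_V node_prob_pos root_in butlast_in children_mass)

text \<open>On the prefixes of one scenario both recursions peel off the factor of the latest stage
  first.\<close>

lemma path_prod_eq_stp:
  assumes "s \<in> set_pmf P" "t \<le> T" "n \<le> t"
    and "\<And>r. r \<le> T \<Longrightarrow> 1 \<le> r \<Longrightarrow> \<Phi>' (take (Suc r) s) = \<Phi> r"
  shows "path_prod butlast \<Phi>' n (take (Suc t) s) = stp \<Phi> (t - n) t"
  using assms(2,3)
proof (induction n arbitrary: t)
  case 0
  then show ?case by (cases t) auto
next
  case (Suc n)
  then obtain t' where t': "t = Suc t'" by (cases t) auto
  have "butlast (take (Suc t) s) = take (Suc t') s" using len assms(1) Suc.prems t' by (simp add: butlast_take)
  then show ?case using Suc.IH[of t'] Suc.prems t' assms(4)[of t] by (simp add: less_Suc_eq_le)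
qed

lemma opnorm_path_prod_le:
  assumes "i \<in> V" "n \<le> stage i - stage k" "1 \<le> L"
    and eq: "\<And>s r. s \<in> set_pmf P \<Longrightarrow> r \<le> T \<Longrightarrow> 1 \<le> r \<Longrightarrow> \<Phi>' (take (Suc r) s) = \<Phi> s r"
    and bd: "\<And>s t' t. s \<in> set_pmf P \<Longrightarrow> t' < t \<Longrightarrow> t \<le> T \<Longrightarrow> opnorm (stp (\<Phi> s) t' t) \<le> L * \<alpha> ^ (t - t')"
  shows "opnorm (path_prod butlast \<Phi>' n i) \<le> L * \<alpha> ^ n"
  using assms(1)
proof (cases rule: nodeE)
  case (1 s t)
  have p: "path_prod butlast \<Phi>' n i = stp (\<Phi> s) (t - n) t"
    unfolding 1(3) using 1 assms(2) by (intro path_prod_eq_stp eq) auto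
  show ?thesis
  \<comment> \<open>The stability assumption covers only t' < t; the empty product needs 1 \<le> L
    instead.\<close>
  proof (cases "n = 0")
    case True
    then show ?thesis using assms(3) by (simp add: opnorm_def order_trans[OF onorm_id_le])
  next
    case False
    then show ?thesis unfolding p using bd[of s "t - n" t] 1 assms(2) by simp
  qed
qed

end

text \<open>Passes from rows scaled by the probability relative to k to rows with the
  child-to-parent ratios used in \<open>lq.adj\<close>.\<close>

lemma scaleR_add_sum_eq_0_iff:
  fixes v :: "'v::real_vector"
  assumes "a > 0" "c > 0"
  shows "(a / c) *\<^sub>R v + (\<Sum>j\<in>J. (b j / c) *\<^sub>R w j) = 0 \<longleftrightarrow> v + (\<Sum>j\<in>J. (b j / a) *\<^sub>R w j) = 0"
proof -
  have "(a / c) *\<^sub>R v + (\<Sum>j\<in>J. (b j / c) *\<^sub>R w j) = (a / c) *\<^sub>R (v + (\<Sum>j\<in>J. (b j / a) *\<^sub>R w j))"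
    using assms by (simp add: scaleR_add_right scaleR_sum_right)
  then show ?thesis using assms by simp
qed

section \<open>From the scenario process to the abstract tree problem\<close>

theorem theoremA3:
  fixes P :: "'a list pmf" and T :: nat and x0 :: 'a
    and A :: "'a \<Rightarrow> real^'nx^'nx" and B :: "'a \<Rightarrow> real^'nu^'nx"
    and Q :: "'a \<Rightarrow> real^'nx^'nx" and R :: "'a \<Rightarrow> real^'nu^'nu"
    and L \<alpha> \<gamma> :: real
    and K :: "nat \<Rightarrow> 'a list \<Rightarrow> real^'nx^'nu"
    and K' :: "nat \<Rightarrow> 'a list \<Rightarrow> real^'nx^'nx"
    and k :: "'a list" and W :: enat
  assumes len: "\<forall>s\<in>set_pmf P. length s = Suc T"
    and A1: "finite (set_pmf P)"
    and symQ: "\<forall>a. transpose (Q a) = Q a"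
    and symR: "\<forall>a. transpose (R a) = R a"
    and L: "1 \<le> L" and \<alpha>: "0 < \<alpha>" "\<alpha> < 1" and \<gamma>: "0 < \<gamma>" "\<gamma> \<le> 1"
    and A2a: "\<forall>s\<in>set_pmf P. \<forall>t\<le>T. opnorm (A (s!t)) \<le> L \<and> opnorm (B (s!t)) \<le> L
                 \<and> opnorm (Q (s!t)) \<le> L \<and> opnorm (R (s!t)) \<le> L"
    and A2b: "\<forall>s\<in>set_pmf P. \<forall>t\<le>T. psd (Q (s!t)) \<and> psd (R (s!t) - mat \<gamma>)"
    and A2c: "\<forall>s\<in>set_pmf P. (\<forall>t<T. opnorm (K t (take (Suc t) s)) \<le> L)
               \<and> (\<forall>t' t''. t' < t'' \<and> t'' \<le> T \<longrightarrow>
                    opnorm (stp (\<lambda>t. A (s!t) - B (s!t) ** K (t - 1) (take t s)) t' t'')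
                      \<le> L * \<alpha> ^ (t'' - t'))"
    and A2d: "\<forall>s\<in>set_pmf P. (\<forall>t. 1 \<le> t \<and> t \<le> T \<longrightarrow> opnorm (K' t (take (Suc t) s)) \<le> L)
               \<and> (\<forall>t' t''. t' < t'' \<and> t'' \<le> T \<longrightarrow>
                    opnorm (stp (\<lambda>t. A (s!t) - K' t (take (Suc t) s) ** psd_sqrt (Q (s!(t - 1)))) t' t'')
                      \<le> L * \<alpha> ^ (t'' - t'))"
    and x0: "x0 \<in> hd ` set_pmf P"
    and k: "k \<in> tree_nodes P T x0"
  shows "\<exists>(\<Omega> :: 'a list \<Rightarrow> 'a list \<Rightarrow> (real^'nx) \<times> (real^'nu) \<times> (real^'nx) \<Rightarrow> (real^'nx) \<times> (real^'nu) \<times> (real^'nx))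
           (\<Psi> :: 'a list \<Rightarrow> 'a list \<Rightarrow> (real^'nx) \<times> (real^'nu) \<times> (real^'nx) \<Rightarrow> (real^'nx) \<times> (real^'nu)).
     (\<forall>i j. linear (\<Omega> i j) \<and> linear (\<Psi> i j))
   \<and> (\<forall>(q :: 'a \<Rightarrow> real^'nx) (r :: 'a \<Rightarrow> real^'nu) (d :: 'a \<Rightarrow> real^'nx).
        let V = win_nodes P T x0 k W;
            p = (\<lambda>i. (q (last i), r (last i), d (last i)))
        in (\<exists>z. EP_KKT P T x0 A B d Q R q r k W z)
         \<and> (\<forall>z z'. EP_KKT P T x0 A B d Q R q r k W z \<and> EP_KKT P T x0 A B d Q R q r k W z'
                   \<longrightarrow> (\<forall>i\<in>V. z i = z' i))
         \<and> (\<forall>z. EP_KKT P T x0 A B d Q R q r k W z \<longrightarrow>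
                (\<forall>i\<in>V. z i = (\<Sum>j\<in>V. \<Omega> i j (p j))
                       \<and> (fst (z i), fst (snd (z i))) = (\<Sum>j\<in>V. \<Psi> i j (p j)))))
   \<and> (\<forall>t\<in>win_stages T k W. \<forall>t'\<in>win_stages T k W.
        max (pinorm (node_prob P x0) (desc P T x0 k t) (desc P T x0 k t') \<Omega>)
            (pinorm (node_prob P x0) (desc P T x0 k t) (desc P T x0 k t') \<Psi>)
        \<le> c_1 L \<alpha> \<gamma> * rho L \<alpha> \<gamma> ^ (if t \<le> t' then t' - t else t - t'))"
proof -
  interpret scenario_window P T x0 k W
    using len A1 k by unfold_locales
  define A' where "A' i = A (last i)" for i :: "'a list"
  define B' where "B' i = B (last i)" for i :: "'a list"
  define Q' where "Q' i = Q (last i)" for i :: "'a list"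
  define R' where "R' i = R (last i)" for i :: "'a list"
  \<comment> \<open>The gain at stage \<open>T\<close> is not bounded by the assumptions, but no closed-loop step uses it.\<close>
  define F where "F i = (if stage i < T then K (stage i) i else 0)" for i :: "'a list"
  define F' where "F' i = K' (stage i) i" for i :: "'a list"
  define S where "S i = psd_sqrt (Q (last i))" for i :: "'a list"
  have take_facts: "last (take (Suc r) s) = s ! r" "butlast (take (Suc r) s) = take r s"
    "stage (take (Suc r) s) = r" "length s = Suc T" if "s \<in> set_pmf P" "r \<le> T" for r s
  proof -
    show l: "length s = Suc T" using len that by simp
    then have "take (Suc r) s = take r s @ [s ! r]" using that by (simp add: take_Suc_conv_app_nth)
    then show "last (take (Suc r) s) = s ! r" "butlast (take (Suc r) s) = take r s" by simp_all
    show "stage (take (Suc r) s) = r" using l that by (simp add: stage_def)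
  qed
  have psdQ: "psd (Q (last i))" and psdR: "psd (R (last i) - mat \<gamma>)" if "i \<in> V" for i
    using that by (auto elim!: nodeE simp: A2b)
  interpret lq: tree_lq V "node_prob P x0" k butlast "\<lambda>i. stage i - stage k" A' B' Q' R' F F' S L \<alpha> \<gamma>
  proof (rule tree_lq.intro, rule weighted_tree_axioms, rule tree_lq_axioms.intro)
    show "opnorm (A' i) \<le> L" "opnorm (B' i) \<le> L" "opnorm (Q' i) \<le> L" "opnorm (R' i) \<le> L" if "i \<in> V" for i
      using that A2a by (auto elim!: nodeE simp: A'_def B'_def Q'_def R'_def)
    show "opnorm (F i) \<le> L" if "i \<in> V" for i
    proof (cases "stage i < T")
      case True
      with that A2c show ?thesis by (auto elim!: nodeE simp: F_def)
    next
      case False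
      then show ?thesis using L by (simp add: F_def opnorm_def onorm_zero)
    qed
    show "opnorm (F' i) \<le> L" if "i \<in> V" "i \<noteq> k" for i
      using that(1)
    proof (cases rule: nodeE)
      case (1 s t)
      then show ?thesis using A2d stage_gt[OF that] by (simp add: F'_def)
    qed
    show "(norm (S i *v x))\<^sup>2 = x \<bullet> (Q' i *v x)" if "i \<in> V" for i x
      using symQ psdQ[OF that] by (simp add: S_def Q'_def psd_sqrt_inner)
    show "\<gamma> * (norm u)\<^sup>2 \<le> u \<bullet> (R' i *v u)" if "i \<in> V" for i u
    proof -
      have "mat \<gamma> *v u = \<gamma> *\<^sub>R u"
        by (simp add: vec_eq_iff mat_def matrix_vector_mult_def if_distrib[of "\<lambda>x. x * _"] sum.delta cong: if_cong)
      then show ?thesis using psdR[OF that, unfolded psd_def, rule_format, of u]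
        by (simp add: R'_def matrix_vector_mult_diff_rdistrib inner_diff_right power2_norm_eq_inner)
    qed
    show "opnorm (path_prod butlast (\<lambda>i. A' i - B' i ** F (butlast i)) n i) \<le> L * \<alpha> ^ n"
      if "i \<in> V" "n \<le> stage i - stage k" for n i
    proof (rule opnorm_path_prod_le[OF that L])
      fix s r assume sr: "s \<in> set_pmf P" "r \<le> T" "1 \<le> r"
      then obtain r' where r': "r = Suc r'" by (cases r) auto
      show "A' (take (Suc r) s) - B' (take (Suc r) s) ** F (butlast (take (Suc r) s))
        = A (s ! r) - B (s ! r) ** K (r - 1) (take r s)"
        using take_facts[OF sr(1,2)] take_facts[OF sr(1), of r'] sr r' by (simp add: A'_def B'_def F_def)
    qed (use A2c in blast)
    show "opnorm (path_prod butlast (\<lambda>i. A' i - F' i ** S (butlast i)) n i) \<le> L * \<alpha> ^ n"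
      if "i \<in> V" "n \<le> stage i - stage k" for n i
    proof (rule opnorm_path_prod_le[OF that L])
      fix s r assume sr: "s \<in> set_pmf P" "r \<le> T" "1 \<le> r"
      then obtain r' where r': "r = Suc r'" by (cases r) auto
      show "A' (take (Suc r) s) - F' (take (Suc r) s) ** S (butlast (take (Suc r) s))
        = A (s ! r) - K' r (take (Suc r) s) ** psd_sqrt (Q (s ! (r - 1)))"
        using take_facts[OF sr(1,2)] take_facts[OF sr(1), of r'] sr r' by (simp add: A'_def F'_def S_def)
    qed (use A2d in blast)
  qed (use L \<alpha> \<gamma> symQ symR in \<open>simp_all add: Q'_def R'_def\<close>)
  \<comment> \<open>\<open>lq.KKT\<close> has \<open>- F\<close> in its last row, so its right-hand side is \<open>(q, r, - d)\<close>.\<close>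
  define \<tau> :: "(real^'nx) \<times> (real^'nu) \<times> (real^'nx) \<Rightarrow> (real^'nx) \<times> (real^'nu) \<times> (real^'nx)"
    where "\<tau> = (\<lambda>(a, b, c). (a, b, - c))"
  define \<pi>w :: "(real^'nx) \<times> (real^'nu) \<times> (real^'nx) \<Rightarrow> (real^'nx) \<times> (real^'nu)"
    where "\<pi>w = (\<lambda>(a, b, c). (a, b))"
  define \<Omega> where "\<Omega> i j v = lq.block i j (\<tau> v)" for i j v
  define \<Psi> where "\<Psi> i j v = \<pi>w (lq.block i j (\<tau> v))" for i j v
  have lin_\<tau>: "linear \<tau>" and lin_\<pi>: "linear \<pi>w"
    by (auto intro!: linearI simp: \<tau>_def \<pi>w_def)
  have norm_\<tau>: "norm (\<tau> v) \<le> norm v" and norm_\<pi>: "norm (\<pi>w v) \<le> norm v" for v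
    by (cases v; auto simp: \<tau>_def \<pi>w_def norm_Pair)+
  have linears: "linear (\<Omega> i j)" "linear (\<Psi> i j)" for i j
    using linear_compose[OF lin_\<tau> lq.linear_block[of i j]]
      linear_compose[OF linear_compose[OF lin_\<tau> lq.linear_block[of i j]] lin_\<pi>]
    by (simp_all add: \<Omega>_def[abs_def] \<Psi>_def[abs_def] o_def)
  \<comment> \<open>Positivity of all node probabilities lets the scaling cancel row by row.\<close>
  have KKT_iff: "EP_KKT P T x0 A B d Q R q r k W z
    \<longleftrightarrow> (\<forall>i\<in>V. lq.KKT z i = \<tau> (q (last i), r (last i), d (last i)))" for q r d z
  proof -
    have kp: "0 < node_prob P x0 k" by (rule node_prob_pos[OF root_in])
    show ?thesis
      unfolding EP_KKT_def Let_def
    proof (rule ball_cong[OF refl], goal_cases)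
      case (1 i)
      have ip: "0 < node_prob P x0 i" by (rule node_prob_pos[OF 1])
      have ch: "{j\<in>V. j \<noteq> k \<and> butlast j = i} = ch i" by (simp add: ch_def)
      have cancel: "(node_prob P x0 i / node_prob P x0 k) *\<^sub>R a = (node_prob P x0 i / node_prob P x0 k) *\<^sub>R b
        \<longleftrightarrow> a = b" for a b :: "real^'nx"
        using ip kp by simp
      have dyn: "((i = k \<longrightarrow> fst (z i) = fdyn A B d 0 0 (last i)) \<and>
          (i \<noteq> k \<longrightarrow> (node_prob P x0 i / node_prob P x0 k) *\<^sub>R fst (z i) = (node_prob P x0 i / node_prob P x0 k) *\<^sub>R
            fdyn A B d (fst (z (butlast i))) (fst (snd (z (butlast i)))) (last i)))
        \<longleftrightarrow> - lq.dyn (\<lambda>i. fst (z i)) (\<lambda>i. fst (snd (z i))) i = - d (last i)"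
        unfolding cancel by (auto simp: lq.dyn_def sh_def fdyn_def A'_def B'_def algebra_simps)
      show ?case
        unfolding ch scaleR_add_sum_eq_0_iff[OF ip kp] dyn
        by (auto simp: lq.KKT_def lq.adj_def \<tau>_def A'_def B'_def Q'_def R'_def algebra_simps
          simp del: transpose_matrix_vector)
    qed
  qed
  show ?thesis
  proof (intro exI[of _ \<Omega>] exI[of _ \<Psi>] conjI allI ballI)
    show "linear (\<Omega> i j)" "linear (\<Psi> i j)" for i j by (fact linears)+
    fix q :: "'a \<Rightarrow> real^'nx" and r :: "'a \<Rightarrow> real^'nu" and d :: "'a \<Rightarrow> real^'nx"
    define p where "p i = (q (last i), r (last i), d (last i))" for i
    have sol: "z i = (\<Sum>j\<in>V. \<Omega> i j (p j))" if "EP_KKT P T x0 A B d Q R q r k W z" "i \<in> V" for z i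
      using lq.sol_unique[of z "\<lambda>i. \<tau> (p i)" i] that
      by (simp add: KKT_iff p_def \<Omega>_def lq.sum_block_V)
    have ex: "\<exists>z. EP_KKT P T x0 A B d Q R q r k W z"
      unfolding KKT_iff by (rule lq.solution_exists)
    have sol_w: "(fst (z i), fst (snd (z i))) = (\<Sum>j\<in>V. \<Psi> i j (p j))"
      if "EP_KKT P T x0 A B d Q R q r k W z" "i \<in> V" for z i
    proof -
      have "(fst (z i), fst (snd (z i))) = \<pi>w (z i)" by (simp add: \<pi>w_def split_beta)
      also have "\<dots> = (\<Sum>j\<in>V. \<Psi> i j (p j))"
        unfolding sol[OF that] by (simp add: linear_sum[OF lin_\<pi>] \<Omega>_def \<Psi>_def)
      finally show ?thesis .
    qed
    show "let V = win_nodes P T x0 k W; p = (\<lambda>i. (q (last i), r (last i), d (last i)))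
        in (\<exists>z. EP_KKT P T x0 A B d Q R q r k W z)
         \<and> (\<forall>z z'. EP_KKT P T x0 A B d Q R q r k W z \<and> EP_KKT P T x0 A B d Q R q r k W z'
                   \<longrightarrow> (\<forall>i\<in>V. z i = z' i))
         \<and> (\<forall>z. EP_KKT P T x0 A B d Q R q r k W z \<longrightarrow>
                (\<forall>i\<in>V. z i = (\<Sum>j\<in>V. \<Omega> i j (p j))
                       \<and> (fst (z i), fst (snd (z i))) = (\<Sum>j\<in>V. \<Psi> i j (p j))))"
    proof (unfold Let_def, intro conjI allI impI ballI, goal_cases)
      case 1
      show ?case by (rule ex)
    next
      case (2 z z' i)
      then show ?case using sol[of z i] sol[of z' i] by simp
    next
      case (3 z i)
      then show ?case using sol[of z i] by (simp add: p_def)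
    next
      case (4 z i)
      then show ?case using sol_w[of z i] by (simp add: p_def)
    qed
  next
    fix t t' assume t: "t \<in> win_stages T k W" "t' \<in> win_stages T k W"
    have rho: "sqrt lq.theta = rho L \<alpha> \<gamma>" by (simp add: lq.theta_def rho_def)
    \<comment> \<open>Depths count from k; the truncated subtraction is exact because window stages
      are at least \<open>stage k\<close>.\<close>
    have e: "(if t - stage k \<le> t' - stage k then t' - stage k - (t - stage k) else t - stage k - (t' - stage k))
      = (if t \<le> t' then t' - t else t - t')"
      using t by (auto simp: win_stages_def)
    show "max (pinorm (node_prob P x0) (desc P T x0 k t) (desc P T x0 k t') \<Omega>)
        (pinorm (node_prob P x0) (desc P T x0 k t) (desc P T x0 k t') \<Psi>)
        \<le> c_1 L \<alpha> \<gamma> * rho L \<alpha> \<gamma> ^ (if t \<le> t' then t' - t else t - t')"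
      using lq.pinorm_block_le[OF linear_id _ norm_\<tau>, of "t - stage k" "t' - stage k"]
        lq.pinorm_block_le[OF lin_\<pi> norm_\<pi> norm_\<tau>, of "t - stage k" "t' - stage k"]
      unfolding e rho by (simp add: desc_eq t c_1_def \<Omega>_def[abs_def] \<Psi>_def[abs_def])
  qed
qed

end
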